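(* Let $\mathfrak{A}$ be a $C^*$-algebra and let $H$ and $K$ be Hilbert $\mathfrak{A}$-modules. For every $T\in\mathcal{L}(H,K)$, there exists a unique operator $V_T\in\mathcal{L}(H,K)$ such that $V_T$ is the reduced solution of the system $$|T^*|^{\frac12}X=T,\quad X\in\mathcal{L}(H,K),$$ and $V_T^*$ is the reduced solution of the system $$|T|^{\frac12}Y=T^*,\quad Y\in\mathcal{L}(K,H).$$ Moreover, $$V_T^*V_T=|T|,\quad V_TV_T^*=|T^*|,$$ $$V_T|T|^\beta=|T^*|^\beta V_T\quad\text{for all }\beta>0,$$ $$\overline{\mathcal{R}(V_T)}=\overline{\mathcal{R}(T)},\quad \overline{\mathcal{R}(V_T^* )}=\overline{\mathcal{R}(T^* )}.$$
   Context: For Hilbert $\mathfrak{A}$-modules $H,K$, $\mathcal{L}(H,K)$ denotes the set of adjointable operators from $H$ to $K$, and $\mathcal{L}(H)=\mathcal{L}(H,H)$. $\mathcal{R}(\cdot)$ denotes the range and the bar denotes norm closure. $|T|=(T^*T)^{1/2}$, and powers of positive operators are defined by the continuous functional calculus. Reduced solution: given Hilbert $\mathfrak{A}$-modules $E,H,K$, $A\in\mathcal{L}(H,K)$ and $C\in\mathcal{L}(E,K)$, an operator $D\in\mathcal{L}(E,H)$ is the reduced solution of the system $AX=C$, $X\in\mathcal{L}(E,H)$, if $AD=C$ and $\mathcal{R}(D)\subseteq\overline{\mathcal{R}(A^* )}$ (it is unique if it exists). *)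

theory Defs
  imports "HOL-Analysis.Analysis"
begin

section \<open>C*-algebras\<close>

class complex_banach = banach +
  fixes scaleC :: "complex \<Rightarrow> 'a \<Rightarrow> 'a"  (infixr "*\<^sub>C" 75)
  assumes scaleC_add_right: "c *\<^sub>C (x + y) = c *\<^sub>C x + c *\<^sub>C y"
    and scaleC_add_left: "(c + d) *\<^sub>C x = c *\<^sub>C x + d *\<^sub>C x"
    and scaleC_scaleC: "c *\<^sub>C (d *\<^sub>C x) = (c * d) *\<^sub>C x"
    and scaleC_of_real: "complex_of_real r *\<^sub>C x = scaleR r x"
    and norm_scaleC: "norm (c *\<^sub>C x) = cmod c * norm x"

text \<open>A unit is not assumed.\<close>

class cstar_algebra = complex_banach + real_normed_algebra +
  fixes star :: "'a \<Rightarrow> 'a"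
  assumes mult_scaleC_left: "(c *\<^sub>C a) * b = c *\<^sub>C (a * b)"
    and mult_scaleC_right: "a * (c *\<^sub>C b) = c *\<^sub>C (a * b)"
    and star_star: "star (star a) = a"
    and star_add: "star (a + b) = star a + star b"
    and star_scaleC: "star (c *\<^sub>C a) = cnj c *\<^sub>C star a"
    and star_mult: "star (a * b) = star b * star a"
    and cstar_identity: "norm (star a * a) = (norm a)\<^sup>2"

definition cstar_positive :: "'a::cstar_algebra \<Rightarrow> bool" where
  "cstar_positive a \<longleftrightarrow> (\<exists>b. a = star b * b)"

section \<open>Hilbert C*-modules and adjointable operators\<close>

text \<open>
  Right modules, with an inner product that is linear in the second variable. The norm of the
  carrier type is required to be the one induced by the inner product; completeness in that norm
  is then part of the type class.
\<close>

locale hilbert_module =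
  fixes act :: "'h::complex_banach \<Rightarrow> 'a::cstar_algebra \<Rightarrow> 'h"
    and ip :: "'h \<Rightarrow> 'h \<Rightarrow> 'a"
  assumes act_add_left: "act (x + y) a = act x a + act y a"
    and act_add_right: "act x (a + b) = act x a + act x b"
    and act_act: "act (act x a) b = act x (a * b)"
    and act_scaleC_left: "act (c *\<^sub>C x) a = c *\<^sub>C act x a"
    and act_scaleC_right: "act x (c *\<^sub>C a) = c *\<^sub>C act x a"
    and ip_add_right: "ip x (y + z) = ip x y + ip x z"
    and ip_scaleC_right: "ip x (c *\<^sub>C y) = c *\<^sub>C ip x y"
    and ip_act_right: "ip x (act y a) = ip x y * a"
    and star_ip: "star (ip x y) = ip y x"
    and ip_positive: "cstar_positive (ip x x)"
    and ip_definite: "ip x x = 0 \<Longrightarrow> x = 0"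
    and norm_eq_sqrt_ip: "norm x = sqrt (norm (ip x x))"

text \<open>
  The operator notions below depend on the module structures only through the inner products.
  Linearity over the complex numbers and over the algebra is a consequence of adjointability.
\<close>

definition is_adjoint ::
  "('h \<Rightarrow> 'h \<Rightarrow> 'a) \<Rightarrow> ('k \<Rightarrow> 'k \<Rightarrow> 'a) \<Rightarrow> ('h \<Rightarrow> 'k) \<Rightarrow> ('k \<Rightarrow> 'h) \<Rightarrow> bool" where
  "is_adjoint ipH ipK T S \<longleftrightarrow> (\<forall>x y. ipK (T x) y = ipH x (S y))"

definition adjointable ::
  "('h \<Rightarrow> 'h \<Rightarrow> 'a) \<Rightarrow> ('k \<Rightarrow> 'k \<Rightarrow> 'a) \<Rightarrow> ('h \<Rightarrow> 'k) set" where
  "adjointable ipH ipK = {T. \<exists>S. is_adjoint ipH ipK T S}"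

definition adj ::
  "('h \<Rightarrow> 'h \<Rightarrow> 'a) \<Rightarrow> ('k \<Rightarrow> 'k \<Rightarrow> 'a) \<Rightarrow> ('h \<Rightarrow> 'k) \<Rightarrow> ('k \<Rightarrow> 'h)" where
  "adj ipH ipK T = (THE S. is_adjoint ipH ipK T S)"

section \<open>Continuous functional calculus\<close>

definition op_spectrum ::
  "('h::complex_banach \<Rightarrow> 'h \<Rightarrow> 'a::cstar_algebra) \<Rightarrow> ('h \<Rightarrow> 'h) \<Rightarrow> complex set" where
  "op_spectrum ip T =
    {z. \<not> (\<exists>S \<in> adjointable ip ip.
              S \<circ> (\<lambda>x. z *\<^sub>C x - T x) = id \<and> (\<lambda>x. z *\<^sub>C x - T x) \<circ> S = id)}"

text \<open>
  A unital *-homomorphism \<open>\<Phi>\<close> from the continuous functions on the spectrum of \<open>T\<close> to the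
  adjointable operators that sends the identity function to \<open>T\<close>. Functions on the spectrum are
  represented by functions on the whole plane, of which only the values on the spectrum matter.
  For normal \<open>T\<close> such a homomorphism exists and is unique on those functions.
\<close>

definition is_functional_calculus ::
  "('h::complex_banach \<Rightarrow> 'h \<Rightarrow> 'a::cstar_algebra) \<Rightarrow> ('h \<Rightarrow> 'h) \<Rightarrow>
    ((complex \<Rightarrow> complex) \<Rightarrow> 'h \<Rightarrow> 'h) \<Rightarrow> bool" where
  "is_functional_calculus ip T \<Phi> \<longleftrightarrow>
    (let C = {f. continuous_on (op_spectrum ip T) f} in
      (\<forall>f\<in>C. \<Phi> f \<in> adjointable ip ip) \<and>
      (\<forall>f\<in>C. \<forall>g\<in>C. (\<forall>z\<in>op_spectrum ip T. f z = g z) \<longrightarrow> \<Phi> f = \<Phi> g) \<and>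
      (\<forall>f\<in>C. \<forall>g\<in>C. \<Phi> (\<lambda>z. f z + g z) = (\<lambda>x. \<Phi> f x + \<Phi> g x)) \<and>
      (\<forall>f\<in>C. \<forall>c. \<Phi> (\<lambda>z. c * f z) = (\<lambda>x. c *\<^sub>C \<Phi> f x)) \<and>
      (\<forall>f\<in>C. \<forall>g\<in>C. \<Phi> (\<lambda>z. f z * g z) = \<Phi> f \<circ> \<Phi> g) \<and>
      (\<forall>f\<in>C. \<Phi> (\<lambda>z. cnj (f z)) = adj ip ip (\<Phi> f)) \<and>
      \<Phi> (\<lambda>z. 1) = id \<and>
      \<Phi> (\<lambda>z. z) = T)"

definition cfc ::
  "('h::complex_banach \<Rightarrow> 'h \<Rightarrow> 'a::cstar_algebra) \<Rightarrow> (complex \<Rightarrow> complex) \<Rightarrow>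
    ('h \<Rightarrow> 'h) \<Rightarrow> ('h \<Rightarrow> 'h)" where
  "cfc ip f T = (THE S. \<exists>\<Phi>. is_functional_calculus ip T \<Phi> \<and> S = \<Phi> f)"

text \<open>
  For positive \<open>T\<close> the spectrum lies in the nonnegative half-line, so the function applied here
  is \<open>t \<mapsto> t powr \<beta>\<close>; it is continuous there for \<open>\<beta> > 0\<close>, the only exponents used.
\<close>

definition op_powr ::
  "('h::complex_banach \<Rightarrow> 'h \<Rightarrow> 'a::cstar_algebra) \<Rightarrow> ('h \<Rightarrow> 'h) \<Rightarrow> real \<Rightarrow> ('h \<Rightarrow> 'h)" where
  "op_powr ip T \<beta> = cfc ip (\<lambda>z. complex_of_real (Re z powr \<beta>)) T"

definition op_abs ::
  "('h::complex_banach \<Rightarrow> 'h \<Rightarrow> 'a::cstar_algebra) \<Rightarrow> ('k::complex_banach \<Rightarrow> 'k \<Rightarrow> 'a) \<Rightarrow>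
    ('h \<Rightarrow> 'k) \<Rightarrow> ('h \<Rightarrow> 'h)" where
  "op_abs ipH ipK T = op_powr ipH (adj ipH ipK T \<circ> T) (1/2)"

section \<open>Reduced solutions\<close>

definition reduced_solution ::
  "('e \<Rightarrow> 'e \<Rightarrow> 'a) \<Rightarrow> ('h::topological_space \<Rightarrow> 'h \<Rightarrow> 'a) \<Rightarrow> ('k \<Rightarrow> 'k \<Rightarrow> 'a) \<Rightarrow>
    ('h \<Rightarrow> 'k) \<Rightarrow> ('e \<Rightarrow> 'k) \<Rightarrow> ('e \<Rightarrow> 'h) \<Rightarrow> bool" where
  "reduced_solution ipE ipH ipK A C D \<longleftrightarrow>
    D \<in> adjointable ipE ipH \<and> A \<circ> D = C \<and> range D \<subseteq> closure (range (adj ipH ipK A))"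

text \<open>\<open>V\<close> is the reduced solution of \<open>|T*|^(1/2) X = T\<close> and \<open>V*\<close> that of \<open>|T|^(1/2) Y = T*\<close>.\<close>

definition common_reduced_solution ::
  "('h::complex_banach \<Rightarrow> 'h \<Rightarrow> 'a::cstar_algebra) \<Rightarrow> ('k::complex_banach \<Rightarrow> 'k \<Rightarrow> 'a) \<Rightarrow>
    ('h \<Rightarrow> 'k) \<Rightarrow> ('h \<Rightarrow> 'k) \<Rightarrow> bool" where
  "common_reduced_solution ipH ipK T V \<longleftrightarrow>
    V \<in> adjointable ipH ipK \<and>
    reduced_solution ipH ipK ipK
      (op_powr ipK (op_abs ipK ipH (adj ipH ipK T)) (1/2)) T V \<and>
    reduced_solution ipK ipH ipH
      (op_powr ipH (op_abs ipH ipK T) (1/2)) (adj ipH ipK T) (adj ipH ipK V)"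

end

theory Submission
  imports Defs "HOL-Computational_Algebra.Fundamental_Theorem_Algebra"
begin

text \<open>
  With \<open>P = T* T\<close>, the operator \<open>V = T P\<^bsup>-1/4\<^esup>\<close> is the pointwise limit of \<open>T g\<^sub>n(P)\<close> where
  \<open>g\<^sub>n(t) = 1 / (t\<^bsup>1/4\<^esup> + 1/(n+1))\<close>: since \<open>T\<close> and \<open>P\<^bsup>1/2\<^esup>\<close> have the same norm on each vector and
  \<open>t\<^bsup>1/2\<^esup> g\<^sub>n(t)\<close> tends uniformly to \<open>t\<^bsup>1/4\<^esup>\<close>, the limit exists. The identity \<open>T f(T* T) = f(T T*) T\<close>
  makes the construction symmetric in \<open>T\<close> and \<open>T*\<close>, and all claims pass to the limit.

  The functional calculus of a self-adjoint \<open>S\<close> extends polynomials in \<open>S\<close> continuously. The bound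
  \<open>\<parallel>p(S)\<parallel> \<le> sup |p|\<close> on the spectrum needs neither Gelfand theory nor holomorphy: if \<open>S\<close> and \<open>G\<close> are
  commuting and self-adjoint, \<open>S x\<close> is the mean of \<open>(S + iG) x\<close> and \<open>(S - iG) x\<close>, whose norms are determined
  by \<open>S\<^sup>2 + G\<^sup>2\<close>; with square roots obtained from Banach's fixed point theorem this shows that \<open>\<parallel>S\<parallel>\<close> or
  \<open>-\<parallel>S\<parallel>\<close> lies in the spectrum.
\<close>

text \<open>A polar decomposition \<open>T = U |T|\<close> cannot serve as the starting point:
  closed submodules of a Hilbert module need not be complemented, so \<open>U\<close> may not exist.
  Since |T|^(1/2) = P^(1/4), the relation V |T|^(1/2) = T leaves T P^(-1/4) as the formal candidate.

  The hidden obstacle is that \<open>P\<close> has nonnegative spectrum, without which its powers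
  mean nothing. Kaplansky's argument adds D* D and D D*, which makes sense only if \<open>D\<close>
  maps a module to itself, so it does not reach an operator from \<open>H\<close> to
  \<open>K\<close>. It is applied instead to left multiplications of the algebra on itself, where it
  shows that a* a + b* b = 0 forces a = 0. This cancellation law, applied to values of the two inner
  products, gives the positivity of T* T.

  Cauchy--Schwarz is therefore available only with the constant 4, which is absorbed by the choice
  of small parameters.\<close>

lemma bounded_linear_scaleC: "bounded_linear (\<lambda>x::'a::complex_banach. c *\<^sub>C x)"
proof (rule bounded_linear_intro[where K = "cmod c"])
  show "c *\<^sub>C (r *\<^sub>R x) = r *\<^sub>R (c *\<^sub>C x)" for r and x :: 'a
    by (simp add: scaleC_of_real[symmetric] scaleC_scaleC mult.commute)
qed (simp_all add: scaleC_add_right norm_scaleC mult.commute)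

lemmas scaleC_zero_right [simp] = bounded_linear.linear[OF bounded_linear_scaleC, THEN linear_0]
lemmas scaleC_minus_right = bounded_linear.linear[OF bounded_linear_scaleC, THEN linear_neg]
lemmas scaleC_diff_right = bounded_linear.linear[OF bounded_linear_scaleC, THEN linear_diff]
lemmas tendsto_scaleC = bounded_linear.tendsto[OF bounded_linear_scaleC]

lemma scaleC_one [simp]: "1 *\<^sub>C x = (x::'a::complex_banach)"
  using scaleC_of_real[of 1 x] by simp

lemma scaleC_zero_left [simp]: "0 *\<^sub>C x = (0::'a::complex_banach)"
  using scaleC_of_real[of 0 x] by simp

lemma scaleC_minus_left: "(- c) *\<^sub>C x = - (c *\<^sub>C (x::'a::complex_banach))"
  using scaleC_add_left[of "- c" c x] by (simp add: eq_neg_iff_add_eq_0)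

section \<open>The algebra of bounded complex-linear operators\<close>

text \<open>The inner product is a locale parameter, so the adjointable operators cannot form a
  type; the bounded complex-linear endomorphisms can. They supply a Banach algebra for fixed point
  and limit arguments, with adjointability kept as a predicate.\<close>

typedef (overloaded) 'h bop =
    "{f :: 'h::complex_banach \<Rightarrow>\<^sub>L 'h. \<forall>c x. blinfun_apply f (c *\<^sub>C x) = c *\<^sub>C blinfun_apply f x}"
  morphisms blinfun_of_bop Bop
  by (rule exI[of _ 0]) simp

setup_lifting type_definition_bop

lift_definition app :: "'h::complex_banach bop \<Rightarrow> 'h \<Rightarrow> 'h" is blinfun_apply .

instantiation bop :: (complex_banach) "{ring, monoid_mult, real_normed_vector}"
begin

lift_definition zero_bop :: "'a bop" is 0 by simp
lift_definition one_bop :: "'a bop" is id_blinfun by simp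
lift_definition plus_bop :: "'a bop \<Rightarrow> 'a bop \<Rightarrow> 'a bop" is "(+)"
  by (simp add: blinfun.add_left scaleC_add_right)
lift_definition minus_bop :: "'a bop \<Rightarrow> 'a bop \<Rightarrow> 'a bop" is "(-)"
  by (simp add: blinfun.diff_left scaleC_diff_right)
lift_definition uminus_bop :: "'a bop \<Rightarrow> 'a bop" is uminus
  by (simp add: blinfun.minus_left scaleC_minus_right)
lift_definition times_bop :: "'a bop \<Rightarrow> 'a bop \<Rightarrow> 'a bop" is "(o\<^sub>L)"
  by simp
lift_definition scaleR_bop :: "real \<Rightarrow> 'a bop \<Rightarrow> 'a bop" is scaleR
  by (simp add: blinfun.scaleR_left scaleC_of_real[symmetric] scaleC_scaleC mult.commute)
lift_definition norm_bop :: "'a bop \<Rightarrow> real" is norm .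

definition "sgn_bop (x::'a bop) = scaleR (inverse (norm x)) x"
definition "dist_bop (x::'a bop) y = norm (x - y)"
definition [code del]: "(uniformity :: ('a bop \<times> 'a bop) filter) =
  (INF e\<in>{0 <..}. principal {(x, y). dist x y < e})"
definition [code del]: "open (U :: 'a bop set) \<longleftrightarrow>
  (\<forall>x\<in>U. eventually (\<lambda>(x', y). x' = x \<longrightarrow> y \<in> U) uniformity)"

instance
proof
  fix a b c :: "'a bop" and r s :: real
  show "a * b * c = a * (b * c)" by transfer (simp add: blinfun_eqI)
  show "(a + b) * c = a * c + b * c" by transfer (simp add: blinfun_eqI blinfun.add_left)
  show "a * (b + c) = a * b + a * c" by transfer (simp add: blinfun_eqI blinfun.add_left blinfun.add_right)
  show "1 * a = a" "a * 1 = a" by (transfer; simp add: blinfun_eqI)+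
  show "norm (a + b) \<le> norm a + norm b" by transfer (rule norm_triangle_ineq)
  show "norm (r *\<^sub>R a) = \<bar>r\<bar> * norm a" by transfer simp
  show "(norm a = 0) = (a = 0)" by transfer simp
qed (simp_all add: sgn_bop_def dist_bop_def uniformity_bop_def open_bop_def,
     (transfer; simp add: algebra_simps)+)

end

instantiation bop :: (complex_banach) "{real_normed_algebra, complex_banach}"
begin

lift_definition scaleC_bop :: "complex \<Rightarrow> 'a bop \<Rightarrow> 'a bop"
  is "\<lambda>c f. Blinfun (\<lambda>x. c *\<^sub>C blinfun_apply f x)"
  subgoal premises * for c f
  proof -
    have "bounded_linear (\<lambda>x. c *\<^sub>C blinfun_apply f x)"
      by (intro bounded_linear_compose[OF bounded_linear_scaleC] blinfun.bounded_linear_right)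
    then show ?thesis
      by (simp add: bounded_linear_Blinfun_apply * scaleC_scaleC mult.commute)
  qed
  done

lemma bop_eqI: "(\<And>x. app S x = app R x) \<Longrightarrow> S = R" for S R :: "'a bop"
  by transfer (rule blinfun_eqI)

lemma norm_app_le: "norm (app S x) \<le> norm S * norm x" for S :: "'a bop"
  by transfer (rule norm_blinfun)

lemma norm_bop_le: "0 \<le> b \<Longrightarrow> (\<And>x. norm (app S x) \<le> b * norm x) \<Longrightarrow> norm S \<le> b" for S :: "'a bop"
  by transfer (rule norm_blinfun_bound)

lemma app_scaleC_left: "app (c *\<^sub>C S) x = c *\<^sub>C app S x" for S :: "'a bop"
  by transfer (auto intro!: fun_cong[OF bounded_linear_Blinfun_apply] bounded_linear_compose[OF bounded_linear_scaleC]
        blinfun.bounded_linear_right)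

lemma app_simps:
  fixes S R :: "'a bop"
  shows "app 0 x = 0" "app 1 x = x" "app (S + R) x = app S x + app R x"
    "app (S - R) x = app S x - app R x" "app (- S) x = - app S x"
    "app (S * R) x = app S (app R x)" "app (r *\<^sub>R S) x = r *\<^sub>R app S x"
  by (transfer; simp add: blinfun.add_left blinfun.diff_left blinfun.minus_left blinfun.scaleR_left)+

lemma app_linear:
  fixes S R :: "'a bop"
  shows "app S 0 = 0" "app S (x + y) = app S x + app S y"
    "app S (x - y) = app S x - app S y" "app S (- x) = - app S x"
    "app S (r *\<^sub>R x) = r *\<^sub>R app S x" "app S (c *\<^sub>C x) = c *\<^sub>C app S x"
  by (transfer; simp add: blinfun.add_right blinfun.diff_right blinfun.minus_right blinfun.scaleR_right)+

instance
proof
  fix a b :: "'a bop" and c d :: complex and r :: real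
  show "norm (a * b) \<le> norm a * norm b" by transfer (rule norm_blinfun_compose)
  show "r *\<^sub>R a * b = r *\<^sub>R (a * b)" "a * r *\<^sub>R b = r *\<^sub>R (a * b)"
    by (rule bop_eqI, simp add: app_simps app_linear)+
  show "c *\<^sub>C (a + b) = c *\<^sub>C a + c *\<^sub>C b" "(c + d) *\<^sub>C a = c *\<^sub>C a + d *\<^sub>C a"
    "c *\<^sub>C (d *\<^sub>C a) = (c * d) *\<^sub>C a" "complex_of_real r *\<^sub>C a = r *\<^sub>R a"
    by (rule bop_eqI, simp add: app_simps app_linear app_scaleC_left scaleC_add_right scaleC_add_left
         scaleC_scaleC scaleC_of_real)+
  have le: "norm (c *\<^sub>C a) \<le> cmod c * norm a" for a :: "'a bop" and c
    by (rule norm_bop_le)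
       (auto simp: app_scaleC_left norm_scaleC mult.assoc intro!: mult_left_mono norm_app_le)
  show "norm (c *\<^sub>C a) = cmod c * norm a"
  proof (cases "c = 0")
    case True
    then show ?thesis using le[of c a] by simp
  next
    case False
    \<comment> \<open>The reverse bound is \<open>le\<close> for the scalar \<open>inverse c\<close>
      and the operator \<open>c *\<^sub>C a\<close>.\<close>
    have "a = inverse c *\<^sub>C c *\<^sub>C a"
      using False by (intro bop_eqI) (simp add: app_scaleC_left scaleC_scaleC)
    then have "norm a \<le> cmod (inverse c) * norm (c *\<^sub>C a)"
      using le[of "inverse c" "c *\<^sub>C a"] by simp
    then have "cmod c * norm a \<le> norm (c *\<^sub>C a)"
      using False by (simp add: norm_divide field_simps)
    with le[of c a] show ?thesis by simp
  qed
next
  fix X :: "nat \<Rightarrow> 'a bop"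
  assume "Cauchy X"
  then have "Cauchy (\<lambda>n. blinfun_of_bop (X n))"
    unfolding Cauchy_def dist_norm by transfer
  then obtain L where L: "(\<lambda>n. blinfun_of_bop (X n)) \<longlonglongrightarrow> L"
    using Cauchy_convergent convergent_def by blast
  have "blinfun_apply L (c *\<^sub>C x) = c *\<^sub>C blinfun_apply L x" for c x
  proof (rule LIMSEQ_unique)
    show "(\<lambda>n. blinfun_of_bop (X n) (c *\<^sub>C x)) \<longlonglongrightarrow> blinfun_apply L (c *\<^sub>C x)"
      by (intro tendsto_intros L)
    have "(\<lambda>n. c *\<^sub>C blinfun_of_bop (X n) x) \<longlonglongrightarrow> c *\<^sub>C blinfun_apply L x"
      by (intro tendsto_intros L tendsto_scaleC)
    moreover have "c *\<^sub>C blinfun_of_bop (X n) x = blinfun_of_bop (X n) (c *\<^sub>C x)" for n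
      using blinfun_of_bop[of "X n"] by simp
    ultimately show "(\<lambda>n. blinfun_of_bop (X n) (c *\<^sub>C x)) \<longlonglongrightarrow> c *\<^sub>C blinfun_apply L x"
      by simp
  qed
  then have L': "blinfun_of_bop (Bop L) = L"
    by (intro Bop_inverse) simp
  have "X \<longlonglongrightarrow> Bop L"
    using L unfolding tendsto_iff dist_norm
    by (simp add: norm_bop.rep_eq minus_bop.rep_eq L')
  then show "convergent X" by (auto simp: convergent_def)
qed

end

lemma mult_scaleC_bop:
  fixes S R :: "'h::complex_banach bop"
  shows "(c *\<^sub>C S) * R = c *\<^sub>C (S * R)" "S * (c *\<^sub>C R) = c *\<^sub>C (S * R)"
  by (rule bop_eqI, simp add: app_simps app_linear app_scaleC_left)+

lemma tendsto_app:
  assumes "(X \<longlongrightarrow> S) F"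
  shows "((\<lambda>n. app (X n) x) \<longlongrightarrow> app S x) F"
proof -
  have "bounded_linear (\<lambda>S. app S x)"
  proof (rule bounded_linear_intro[where K = "norm x"])
    show "norm (app S x) \<le> norm S * norm x" for S
      by (rule norm_app_le)
  qed (simp_all add: app_simps)
  from bounded_linear.tendsto[OF this assms] show ?thesis .
qed

lemma bounded_linear_app: "bounded_linear (app S)"
proof (rule bounded_linear_intro[where K = "norm S"])
  show "norm (app S x) \<le> norm x * norm S" for x
    using norm_app_le[of S x] by (simp add: mult.commute)
qed (simp_all add: app_linear)

lemma bop_of_fun:
  assumes "bounded_linear f" "\<And>c x. f (c *\<^sub>C x) = c *\<^sub>C f x"
  obtains S where "app S = f"
proof -
  have "blinfun_apply (blinfun_of_bop (Bop (Blinfun f))) = f"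
    using assms by (subst Bop_inverse) (auto simp: bounded_linear_Blinfun_apply)
  then show thesis using that by (metis app.rep_eq)
qed

section \<open>Polynomials in an operator\<close>

definition poly_op :: "complex poly \<Rightarrow> 'h::complex_banach bop \<Rightarrow> 'h bop" where
  "poly_op p S = fold_coeffs (\<lambda>a X. a *\<^sub>C 1 + S * X) p 0"

lemma poly_op_0 [simp]: "poly_op 0 S = 0"
  by (simp add: poly_op_def)

lemma poly_op_pCons: "poly_op (pCons a p) S = a *\<^sub>C 1 + S * poly_op p S"
  by (cases "p = 0 \<and> a = 0") (auto simp: poly_op_def)

lemma poly_op_add: "poly_op (p + q) S = poly_op p S + poly_op q S"
  by (induction p q rule: poly_induct2)
     (simp_all add: poly_op_pCons scaleC_add_left algebra_simps)

lemma poly_op_smult: "poly_op (smult c p) S = c *\<^sub>C poly_op p S"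
  by (induction p)
     (simp_all add: poly_op_pCons scaleC_add_right scaleC_scaleC mult_scaleC_bop)

lemma poly_op_mult: "poly_op (p * q) S = poly_op p S * poly_op q S"
  by (induction p)
     (simp_all add: poly_op_pCons poly_op_add poly_op_smult mult_scaleC_bop algebra_simps)

lemma poly_op_diff: "poly_op (p - q) S = poly_op p S - poly_op q S"
  using poly_op_add[of "p - q" q S] by simp

abbreviation cpoly :: "real poly \<Rightarrow> complex poly" where
  "cpoly \<equiv> map_poly complex_of_real"

lemma cpoly_pCons: "cpoly (pCons a p) = pCons (complex_of_real a) (cpoly p)"
  by (simp add: map_poly_pCons)

lemma cpoly_simps:
  "cpoly (p + q) = cpoly p + cpoly q" "cpoly (p - q) = cpoly p - cpoly q"
  "cpoly (p * q) = cpoly p * cpoly q" "cpoly (smult r p) = smult (complex_of_real r) (cpoly p)"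
  "cpoly 1 = 1"
  by (rule poly_eqI, simp add: coeff_map_poly coeff_mult)+

lemma poly_cpoly: "poly (cpoly p) (complex_of_real t) = complex_of_real (poly p t)"
  by (induction p) (simp_all add: cpoly_pCons)

text \<open>Real coefficients keep self-adjointness; the detour through complex ones lets the
  polynomial be split into linear factors later.\<close>

definition rpoly_op :: "real poly \<Rightarrow> 'h::complex_banach bop \<Rightarrow> 'h bop" where
  "rpoly_op p S = poly_op (cpoly p) S"

lemma rpoly_op_simps:
  "rpoly_op 0 S = 0" "rpoly_op (pCons a p) S = a *\<^sub>R 1 + S * rpoly_op p S"
  "rpoly_op (p + q) S = rpoly_op p S + rpoly_op q S" "rpoly_op (p - q) S = rpoly_op p S - rpoly_op q S"
  "rpoly_op (p * q) S = rpoly_op p S * rpoly_op q S" "rpoly_op (smult r p) S = r *\<^sub>R rpoly_op p S"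
  by (simp_all add: rpoly_op_def cpoly_pCons cpoly_simps poly_op_pCons poly_op_add poly_op_diff poly_op_mult
      poly_op_smult scaleC_of_real)

section \<open>Inner products and adjointable operators\<close>

text \<open>By Baire's theorem one of the closed sets \<open>C n\<close> contains a ball of radius
  \<open>r\<close>; a vector of norm \<open>r\<close> is a difference of two points of it, whence
  the constant \<open>2 * n / r\<close>. The purpose is to bound adjointable maps, which are not
  assumed continuous.\<close>

lemma uniform_boundedness:
  fixes F :: "('a::banach \<Rightarrow> 'b::real_normed_vector) set"
  assumes lin: "\<And>f. f \<in> F \<Longrightarrow> bounded_linear f"
    and pw: "\<And>x. \<exists>c. \<forall>f\<in>F. norm (f x) \<le> c"
  obtains M where "M \<ge> 0" "\<And>f x. f \<in> F \<Longrightarrow> norm (f x) \<le> M * norm x"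
proof -
  define C where "C n = {x. \<forall>f\<in>F. norm (f x) \<le> real n}" for n
  have closed: "closed (C n)" for n
  proof -
    have "C n = (\<Inter>f\<in>F. {x. norm (f x) \<le> real n})"
      by (auto simp: C_def)
    moreover have "closed {x. norm (f x) \<le> real n}" if "f \<in> F" for f
      by (intro closed_Collect_le continuous_intros linear_continuous_on lin that)
    ultimately show ?thesis by auto
  qed
  have "\<Union>(range C) = UNIV"
  proof -
    have "\<exists>n. x \<in> C n" for x
    proof -
      obtain c where c: "\<forall>f\<in>F. norm (f x) \<le> c" using pw by blast
      obtain n where "c \<le> real n" using real_arch_simple by blast
      with c show ?thesis by (auto simp: C_def intro!: exI[of _ n] intro: order_trans)
    qed
    then show ?thesis by auto
  qed
  moreover have "euclidean interior_of \<Union>(range C) = {}" if "\<And>n. interior (C n) = {}"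
    using that closed
    by (intro Baire_category_alt) (auto simp: completely_metrizable_space_euclidean)
  ultimately obtain n where "interior (C n) \<noteq> {}" by fastforce
  then obtain x0 r where r: "r > 0" "cball x0 r \<subseteq> C n"
    by (metis all_not_in_conv mem_interior_cball)
  have "norm (f x) \<le> (2 * n / r) * norm x" if f: "f \<in> F" for f x
  proof (cases "x = 0")
    case True
    then show ?thesis using linear_0[OF bounded_linear.linear[OF lin[OF f]]] by simp
  next
    case False
    define z where "z = (r / norm x) *\<^sub>R x"
    have "x0 + z \<in> C n" "x0 \<in> C n"
      using r False by (auto simp: z_def dist_norm subset_iff)
    then have "norm (f (x0 + z)) \<le> n" "norm (f x0) \<le> n"
      using f by (auto simp: C_def)
    moreover have "f z = f (x0 + z) - f x0"
      using linear_add[OF bounded_linear.linear[OF lin[OF f]]] by simp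
    ultimately have "norm (f z) \<le> 2 * n"
      using norm_triangle_ineq4[of "f (x0 + z)" "f x0"] by simp
    moreover have "norm (f z) = r / norm x * norm (f x)"
      unfolding z_def linear_scale[OF bounded_linear.linear[OF lin[OF f]]] using r by simp
    ultimately show ?thesis using r False by (simp add: field_simps)
  qed
  then show thesis using that[of "2 * n / r"] r by simp
qed

lemma star_simps:
  fixes a b :: "'a::cstar_algebra"
  shows "star 0 = (0::'a)" "star (- a) = - star a" "star (a - b) = star a - star b"
    "star (r *\<^sub>R a) = r *\<^sub>R star a"
proof -
  show 0: "star 0 = (0::'a)" using star_scaleC[of 0 "0::'a"] by simp
  show m: "star (- a) = - star a" for a :: 'a
    using star_add[of a "- a"] 0 by (simp add: eq_neg_iff_add_eq_0 add.commute)
  show "star (a - b) = star a - star b"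
    using star_add[of a "- b"] m by simp
  show "star (r *\<^sub>R a) = r *\<^sub>R star a"
    using star_scaleC[of "complex_of_real r" a] by (simp add: scaleC_of_real)
qed

context hilbert_module
begin

lemma ip_add_left: "ip (x + y) z = ip x z + ip y z"
  using ip_add_right[of z x y] by (metis star_add star_ip)

lemma ip_scaleC_left: "ip (c *\<^sub>C x) y = cnj c *\<^sub>C ip x y"
  using ip_scaleC_right[of y c x] by (metis star_scaleC star_ip)

lemma ip_scaleR: "ip (r *\<^sub>R x) y = r *\<^sub>R ip x y" "ip x (r *\<^sub>R y) = r *\<^sub>R ip x y"
  using ip_scaleC_left[of "complex_of_real r" x y] ip_scaleC_right[of x "complex_of_real r" y]
  by (simp_all add: scaleC_of_real)

lemma ip_zero: "ip 0 x = 0" "ip x 0 = 0"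
  using ip_scaleR(1)[of 0 0 x] ip_scaleR(2)[of x 0 0] by simp_all

lemma ip_minus: "ip (- x) y = - ip x y" "ip x (- y) = - ip x y"
  using ip_add_left[of x "- x" y] ip_add_right[of x y "- y"]
  by (simp_all add: ip_zero eq_neg_iff_add_eq_0 add.commute)

lemma ip_diff: "ip (x - y) z = ip x z - ip y z" "ip z (x - y) = ip z x - ip z y"
  using ip_add_left[of x "- y" z] ip_add_right[of z x "- y"] by (simp_all add: ip_minus)

lemmas ip_simps = ip_add_left ip_add_right ip_scaleC_left ip_scaleC_right ip_scaleR ip_zero
  ip_minus ip_diff

lemma norm_ip_self: "norm (ip x x) = (norm x)\<^sup>2"
  using norm_eq_sqrt_ip[of x] by simp

text \<open>The triangle inequality of the norm replaces the order of the algebra: polarization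
  yields the Cauchy--Schwarz inequality up to a constant, which suffices here.\<close>

lemma norm_ip_le: "norm (ip x y) \<le> 4 * norm x * norm y"
proof -
  have unit: "norm (ip x y) \<le> 4" if "norm x = 1" "norm y = 1" for x y
  proof -
    define d where "d y = ip (x + y) (x + y) - ip (x - y) (x - y)" for y
    have d: "norm (d y) \<le> 8" if "norm y = 1" for y
    proof -
      have "norm (d y) \<le> (norm (x + y))\<^sup>2 + (norm (x - y))\<^sup>2"
        unfolding d_def using norm_triangle_ineq4 by (metis norm_ip_self)
      moreover have "norm (x + y) \<le> 2" "norm (x - y) \<le> 2"
        using norm_triangle_ineq[of x y] norm_triangle_ineq4[of x y] \<open>norm x = 1\<close> that by auto
      then have "(norm (x + y))\<^sup>2 \<le> 2\<^sup>2" "(norm (x - y))\<^sup>2 \<le> 2\<^sup>2"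
        by (intro power_mono; simp)+
      ultimately show ?thesis by simp
    qed
    have dy: "d y = 2 *\<^sub>R ip x y + 2 *\<^sub>R ip y x" for y
      by (simp add: d_def ip_simps scaleR_2)
    have "\<i> *\<^sub>C d (\<i> *\<^sub>C y) = 2 *\<^sub>R ip y x - 2 *\<^sub>R ip x y"
      unfolding dy by (simp add: ip_simps scaleC_add_right scaleC_diff_right scaleC_minus_right scaleC_scaleC scaleC_minus_left scaleR_2)
    \<comment> \<open>The terms \<open>ip y x\<close> cancel in this combination. Each of its two
      summands has norm at most 8 on unit vectors, so the final constant is 16 / 4 = 4.\<close>
    then have "4 *\<^sub>R ip x y = d y - \<i> *\<^sub>C d (\<i> *\<^sub>C y)"
      by (simp add: dy scaleR_2[symmetric] scaleR_left_distrib[symmetric])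
    also have "norm \<dots> \<le> norm (d y) + norm (d (\<i> *\<^sub>C y))"
      by (metis norm_triangle_ineq4 norm_scaleC norm_ii mult_1)
    also have "\<dots> \<le> 16"
      using d[of y] d[of "\<i> *\<^sub>C y"] that by (simp add: norm_scaleC)
    finally show ?thesis by simp
  qed
  show ?thesis
  proof (cases "x = 0 \<or> y = 0")
    case False
    have "norm (ip (inverse (norm x) *\<^sub>R x) (inverse (norm y) *\<^sub>R y)) \<le> 4"
      using False by (intro unit) simp_all
    with False show ?thesis by (simp add: ip_scaleR field_simps)
  qed (auto simp: ip_zero)
qed

lemma bounded_bilinear_ip: "bounded_bilinear ip"
  by (rule bounded_bilinear.intro)
     (auto simp: ip_simps intro!: exI[of _ 4] order_trans[OF norm_ip_le])

lemmas tendsto_ip = bounded_bilinear.tendsto[OF bounded_bilinear_ip]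

lemma ip_eqI: "(\<And>z. ip z x = ip z y) \<Longrightarrow> x = y"
  using ip_definite[of "x - y"] by (simp add: ip_diff)

end

lemma is_adjoint_sym:
  assumes "hilbert_module actH ipH" "hilbert_module actK ipK" "is_adjoint ipH ipK T S"
  shows "is_adjoint ipK ipH S T"
  using assms unfolding is_adjoint_def by (metis hilbert_module.star_ip)

lemma is_adjoint_unique:
  assumes "hilbert_module actH ipH" "is_adjoint ipH ipK T S" "is_adjoint ipH ipK T S'"
  shows "S = S'"
  using assms unfolding is_adjoint_def by (metis ext hilbert_module.ip_eqI)

lemma adj_eq:
  assumes "hilbert_module actH ipH" "is_adjoint ipH ipK T S"
  shows "adj ipH ipK T = S"
  unfolding adj_def using assms by (blast intro: is_adjoint_unique)

lemma is_adjoint_linear: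
  assumes "hilbert_module actH ipH" "hilbert_module actK ipK" "is_adjoint ipH ipK T S"
  shows "T (x + y) = T x + T y" "T (c *\<^sub>C x) = c *\<^sub>C T x" "T (r *\<^sub>R x) = r *\<^sub>R T x"
proof -
  interpret H: hilbert_module actH ipH by fact
  interpret K: hilbert_module actK ipK by fact
  have S: "ipK z (T x) = ipH (S z) x" for z x
    using is_adjoint_sym[OF assms] by (simp add: is_adjoint_def)
  show "T (x + y) = T x + T y" "T (c *\<^sub>C x) = c *\<^sub>C T x" "T (r *\<^sub>R x) = r *\<^sub>R T x"
    by (rule K.ip_eqI, simp add: S K.ip_simps H.ip_simps)+
qed

text \<open>Automatic continuity: the maps \<open>ipK (T x)\<close> with
  \<open>norm x \<le> 1\<close> are pointwise bounded because their value at \<open>y\<close> is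
  \<open>ipH x (S y)\<close>. The uniform bound, evaluated at \<open>y = T x\<close>, controls the
  square of \<open>norm (T x)\<close>.\<close>

lemma is_adjoint_bounded_linear:
  assumes "hilbert_module actH ipH" "hilbert_module actK ipK" "is_adjoint ipH ipK T S"
  shows "bounded_linear T"
proof -
  interpret H: hilbert_module actH ipH by fact
  interpret K: hilbert_module actK ipK by fact
  have T: "ipK (T x) y = ipH x (S y)" for x y
    using assms by (simp add: is_adjoint_def)
  define F where "F = (\<lambda>x. ipK (T x)) ` {x. norm x \<le> 1}"
  have "bounded_linear f" if "f \<in> F" for f
    using that bounded_bilinear.bounded_linear_right[OF K.bounded_bilinear_ip] by (auto simp: F_def)
  moreover have "\<exists>c. \<forall>f\<in>F. norm (f y) \<le> c" for y
  proof -
    have "norm (ipH x (S y)) \<le> 4 * norm (S y)" if "norm x \<le> 1" for x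
      using order_trans[OF H.norm_ip_le] that mult_right_mono[OF that, of "norm (S y)"] by simp
    then show ?thesis by (auto simp: F_def T)
  qed
  ultimately obtain M where "M \<ge> 0" and M: "\<And>f y. f \<in> F \<Longrightarrow> norm (f y) \<le> M * norm y"
    using uniform_boundedness[of F] by blast
  have le: "norm (T x) \<le> M" if "norm x \<le> 1" for x
  proof (cases "T x = 0")
    case True
    then show ?thesis using \<open>M \<ge> 0\<close> by simp
  next
    case False
    have "(norm (T x))\<^sup>2 \<le> M * norm (T x)"
      using M[of "ipK (T x)" "T x"] that by (auto simp: F_def K.norm_ip_self)
    with False show ?thesis by (simp add: power2_eq_square)
  qed
  show ?thesis
  proof (rule bounded_linear_intro[where K = M])
    show "norm (T x) \<le> norm x * M" for x
    proof (cases "x = 0")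
      case True
      then show ?thesis using is_adjoint_linear(3)[OF assms, of 0 0] by simp
    next
      case False
      then have "norm (T (inverse (norm x) *\<^sub>R x)) \<le> M"
        by (intro le) simp
      with False show ?thesis
        by (simp add: is_adjoint_linear[OF assms] field_simps)
    qed
  qed (rule is_adjoint_linear[OF assms])+
qed

lemma commute_mult:
  fixes a b x :: "'a::semigroup_mult"
  assumes "x * a = a * x" "x * b = b * x"
  shows "x * (a * b) = a * b * x"
proof -
  have "x * (a * b) = a * (x * b)" using assms(1) by (simp add: mult.assoc[symmetric])
  then show ?thesis using assms(2) by (simp add: mult.assoc)
qed

lemma commute_square:
  fixes a b :: "'a::semigroup_mult"
  assumes "a * b = b * a"
  shows "(a * b) * (a * b) = (a * a) * (b * b)"
proof -
  have "(a * b) * (a * b) = a * (b * a) * b" by (simp only: mult.assoc)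
  then show ?thesis using assms[symmetric] by (simp only: mult.assoc)
qed

section \<open>Endomorphisms of one module and their adjoints\<close>

context hilbert_module
begin

text \<open>A relation rather than a use of \<open>adj\<close>: it carries the existence of the
  adjoint together with its value.\<close>

definition adjp :: "'h bop \<Rightarrow> 'h bop \<Rightarrow> bool" where
  "adjp S S' \<longleftrightarrow> is_adjoint ip ip (app S) (app S')"

abbreviation sa :: "'h bop \<Rightarrow> bool" where
  "sa S \<equiv> adjp S S"

text \<open>The inverse must itself have an adjoint, to match \<open>op_spectrum\<close>, where
  inverses are taken among adjointable operators.\<close>

definition inv_op :: "'h bop \<Rightarrow> bool" where
  "inv_op B \<longleftrightarrow> (\<exists>R R'. adjp R R' \<and> R * B = 1 \<and> B * R = 1)"

lemma adjpD: "adjp S S' \<Longrightarrow> ip (app S x) y = ip x (app S' y)"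
  by (simp add: adjp_def is_adjoint_def)

lemma adjp_sym: "adjp S S' \<Longrightarrow> adjp S' S"
  unfolding adjp_def by (rule is_adjoint_sym[OF hilbert_module_axioms hilbert_module_axioms])

lemma adjp_intros:
  "adjp 0 0" "adjp 1 1"
  "adjp S S' \<Longrightarrow> adjp R R' \<Longrightarrow> adjp (S + R) (S' + R')"
  "adjp S S' \<Longrightarrow> adjp R R' \<Longrightarrow> adjp (S - R) (S' - R')"
  "adjp S S' \<Longrightarrow> adjp R R' \<Longrightarrow> adjp (S * R) (R' * S')"
  "adjp S S' \<Longrightarrow> adjp (- S) (- S')"
  "adjp S S' \<Longrightarrow> adjp (r *\<^sub>R S) (r *\<^sub>R S')"
  "adjp S S' \<Longrightarrow> adjp (c *\<^sub>C S) (cnj c *\<^sub>C S')"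
  by (simp_all add: adjp_def is_adjoint_def app_simps app_scaleC_left ip_simps)

lemma adjp_limit:
  assumes "X \<longlonglongrightarrow> S" "X' \<longlonglongrightarrow> S'" "\<And>n. adjp (X n) (X' n)"
  shows "adjp S S'"
  unfolding adjp_def is_adjoint_def
proof (intro allI LIMSEQ_unique)
  fix x y
  show "(\<lambda>n. ip (app (X n) x) y) \<longlonglongrightarrow> ip (app S x) y"
    by (intro tendsto_ip tendsto_app assms tendsto_const)
  show "(\<lambda>n. ip (app (X n) x) y) \<longlonglongrightarrow> ip x (app S' y)"
    unfolding adjpD[OF assms(3)] by (intro tendsto_ip tendsto_app assms tendsto_const)
qed

lemma closed_sa: "closed {S. sa S}"
  unfolding closed_sequential_limits using adjp_limit by blast

lemma adjointable_bop:
  assumes "is_adjoint ip ip f g"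
  obtains S where "app S = f"
  using bop_of_fun[OF is_adjoint_bounded_linear[OF hilbert_module_axioms hilbert_module_axioms assms]]
    is_adjoint_linear(2)[OF hilbert_module_axioms hilbert_module_axioms assms] by blast

lemma adjointable_adjp:
  assumes "f \<in> adjointable ip ip"
  obtains S S' where "app S = f" "adjp S S'"
proof -
  obtain g where g: "is_adjoint ip ip f g" using assms by (auto simp: adjointable_def)
  obtain S where S: "app S = f" using adjointable_bop[OF g] .
  have "is_adjoint ip ip g f" using g by (rule is_adjoint_sym[OF hilbert_module_axioms hilbert_module_axioms])
  then obtain S' where "app S' = g" using adjointable_bop by blast
  with S g that show thesis by (auto simp: adjp_def)
qed

lemma norm_app_sq: "adjp S S' \<Longrightarrow> (norm (app S x))\<^sup>2 = norm (ip x (app (S' * S) x))"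
  by (simp add: app_simps adjpD norm_ip_self[symmetric])

text \<open>A substitute for the order relation between \<open>S * S\<close> and
  \<open>S * S + G * G\<close>. Commutation makes \<open>U * V\<close> and \<open>V * U\<close> both
  equal to the latter. The uses pair an operator with a square root that completes its square to an
  operator with a known bound.\<close>

lemma norm_sa_sq_commuting:
  assumes S: "sa S" and G: "sa G" and comm: "S * G = G * S"
  shows "(norm (app S x))\<^sup>2 \<le> norm (ip x (app (S * S + G * G) x))"
proof -
  define c where "c = norm (ip x (app (S * S + G * G) x))"
  define U where "U = S + \<i> *\<^sub>C G"
  define V where "V = S - \<i> *\<^sub>C G"
  have UV: "adjp U V" "adjp V U"
    using adjp_intros(3)[OF S adjp_intros(8)[OF G, of \<i>]] adjp_sym
    by (auto simp: U_def V_def scaleC_minus_left)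
  have "V * U = S * S + G * G" "U * V = S * S + G * G"
    by (simp_all add: U_def V_def algebra_simps mult_scaleC_bop scaleC_scaleC comm scaleC_minus_left
        scaleC_diff_right scaleC_add_right)
  then have "(norm (app U x))\<^sup>2 = c" "(norm (app V x))\<^sup>2 = c"
    using UV norm_app_sq unfolding c_def by metis+
  then have n: "norm (app U x) = sqrt c" "norm (app V x) = sqrt c"
    by (auto intro: real_sqrt_unique[symmetric])
  have "2 *\<^sub>R app S x = app U x + app V x"
    by (simp add: U_def V_def app_simps scaleR_2)
  then have "2 * norm (app S x) \<le> 2 * sqrt c"
    using norm_triangle_ineq[of "app U x" "app V x"] n by (metis mult_2 norm_scaleR abs_numeral)
  then have "(norm (app S x))\<^sup>2 \<le> (sqrt c)\<^sup>2"
    by (intro power_mono) auto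
  then show ?thesis by (simp add: c_def)
qed

section \<open>Spectra of self-adjoint operators\<close>

lemma inverse_adjp:
  assumes "adjp B B'" "B * R = 1" "B' * R' = 1"
  shows "adjp R R'"
  unfolding adjp_def is_adjoint_def
proof (intro allI)
  fix x y
  have "ip (app R x) y = ip (app R x) (app B' (app R' y))"
    using assms(3) by (metis app_simps(2,6))
  also have "\<dots> = ip (app B (app R x)) (app R' y)"
    by (simp add: adjpD[OF assms(1)])
  also have "\<dots> = ip x (app R' y)"
    using assms(2) by (metis app_simps(2,6))
  finally show "ip (app R x) y = ip x (app R' y)" .
qed

lemma inv_op_sa:
  assumes "inv_op B" "sa B"
  obtains R where "sa R" "R * B = 1" "B * R = 1"
  using assms inverse_adjp unfolding inv_op_def by metis

lemma inv_op_mult: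
  assumes "inv_op A" "inv_op B"
  shows "inv_op (A * B)"
proof -
  obtain R R' Q Q' where R: "adjp R R'" "R * A = 1" "A * R = 1" and Q: "adjp Q Q'" "Q * B = 1" "B * Q = 1"
    using assms unfolding inv_op_def by blast
  have "Q * R * (A * B) = Q * (R * A) * B" "A * B * (Q * R) = A * (B * Q) * R"
    by (simp_all add: mult.assoc)
  then show ?thesis using R Q adjp_intros(5)[OF Q(1) R(1)] unfolding inv_op_def by auto
qed

lemma inv_op_scaleC:
  assumes "inv_op A" "c \<noteq> 0"
  shows "inv_op (c *\<^sub>C A)"
proof -
  obtain R R' where R: "adjp R R'" "R * A = 1" "A * R = 1"
    using assms unfolding inv_op_def by blast
  have "inverse c *\<^sub>C R * c *\<^sub>C A = 1" "c *\<^sub>C A * inverse c *\<^sub>C R = 1"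
    using R assms(2) by (simp_all add: mult_scaleC_bop scaleC_scaleC)
  then show ?thesis using adjp_intros(8)[OF R(1)] unfolding inv_op_def by blast
qed

lemma inv_op_scaleR:
  assumes "inv_op A" "r \<noteq> 0"
  shows "inv_op (r *\<^sub>R A)"
  using inv_op_scaleC[OF assms(1), of "complex_of_real r"] assms(2) by (simp add: scaleC_of_real)

lemma inv_op_scaleR_iff: "r \<noteq> 0 \<Longrightarrow> inv_op (r *\<^sub>R A) \<longleftrightarrow> inv_op A"
  using inv_op_scaleR[of A r] inv_op_scaleR[of "r *\<^sub>R A" "inverse r"] by auto

lemma inv_op_one: "inv_op 1"
  unfolding inv_op_def using adjp_intros(2) by (metis mult_1)

text \<open>\<open>B * R\<close> is a right inverse and \<open>R * B\<close> a left inverse, so they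
  coincide; the adjoint of \<open>B\<close> makes this inverse adjointable.\<close>

lemma inv_op_factor:
  assumes "inv_op (A * B)" "A * B = B * A" "adjp B B'"
  shows "inv_op A"
proof -
  obtain R R' where R: "adjp R R'" "R * (A * B) = 1" "A * B * R = 1"
    using assms unfolding inv_op_def by blast
  have right: "A * (B * R) = 1" using R(3) by (simp add: mult.assoc)
  have left: "R * B * A = 1" using R(2) assms(2) by (simp add: mult.assoc)
  have "R * B = R * B * (A * (B * R))" using right by simp
  also have "\<dots> = B * R" using left by (metis mult.assoc mult_1)
  finally have "R * B = B * R" .
  then show ?thesis
    using left right adjp_intros(5)[OF R(1) assms(3)] unfolding inv_op_def by auto
qed

section \<open>Perturbations of the identity, square roots and positivity\<close>

lemma right_inverse_exists:
  fixes E :: "'h bop"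
  assumes "norm E < 1"
  shows "\<exists>R. (1 - E) * R = 1" "\<exists>R. R * (1 - E) = 1"
proof -
  have "norm (E * R - E * R') \<le> norm E * norm (R - R')"
    "norm (R * E - R' * E) \<le> norm E * norm (R - R')" for R R'
    using norm_mult_ineq[of E "R - R'"] norm_mult_ineq[of "R - R'" E]
    by (simp_all add: right_diff_distrib left_diff_distrib mult.commute)
  \<comment> \<open>Right and left inverses of \<open>1 - E\<close> are the fixed points of these
    two contractions, which replaces the Neumann series.\<close>
  then have "\<exists>!R. 1 + E * R = R" "\<exists>!R. 1 + R * E = R"
    using assms by (intro banach_fix_type[of "norm E"]; simp add: dist_norm)+
  then obtain R R' where "1 + E * R = R" "1 + R' * E = R'" by blast
  then have "(1 - E) * R = 1" "R' * (1 - E) = 1"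
    by (simp_all add: left_diff_distrib right_diff_distrib diff_eq_eq)
  then show "\<exists>R. (1 - E) * R = 1" "\<exists>R. R * (1 - E) = 1" by blast+
qed

text \<open>A right inverse of \<open>1 - E'\<close> is required too, because it becomes the adjoint
  of the inverse of \<open>1 - E\<close>; hence a norm condition on each.\<close>

lemma inv_op_one_minus:
  assumes "adjp E E'" "norm E < 1" "norm E' < 1"
  shows "inv_op (1 - E)"
proof -
  obtain R R2 R' where R: "(1 - E) * R = 1" "R2 * (1 - E) = 1" "(1 - E') * R' = 1"
    using right_inverse_exists assms by metis
  have "R2 = R2 * ((1 - E) * R)" using R by simp
  also have "\<dots> = R" using R by (metis mult.assoc mult_1)
  finally have "R * (1 - E) = 1" using R by simp
  moreover have "adjp R R'"
    by (rule inverse_adjp[OF adjp_intros(4)[OF adjp_intros(2) assms(1)]]) (use R in auto)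
  ultimately show ?thesis using R unfolding inv_op_def by blast
qed

lemma inv_op_scaleR_minus:
  assumes "sa E" "norm E < \<bar>r\<bar>"
  shows "inv_op (r *\<^sub>R 1 - E)"
proof -
  have r: "r \<noteq> 0" using assms(2) norm_ge_zero[of E] by linarith
  have "norm (inverse r *\<^sub>R E) < 1" using assms(2) r by (simp add: field_simps)
  then have "inv_op (1 - inverse r *\<^sub>R E)"
    by (intro inv_op_one_minus[where E' = "inverse r *\<^sub>R E"] adjp_intros assms)
  from inv_op_scaleR[OF this r] r show ?thesis by (simp add: scaleR_diff_right)
qed

text \<open>Putting \<open>R = 1 - k\<close> turns the equation into
  \<open>2 *\<^sub>R k = S + k * k\<close>, a fixed point equation for \<open>f\<close>. It is
  solved in the closed set \<open>X\<close> of self-adjoint operators that commute with everything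
  commuting with \<open>S\<close>, so the solution inherits both properties.\<close>

lemma sqrt_one_minus:
  assumes S: "sa S" "norm S < 1"
  obtains R where "sa R" "R * R = 1 - S" "\<And>B. B * S = S * B \<Longrightarrow> B * R = R * B"
proof -
  \<comment> \<open>The smaller root of \<open>\<rho>\<^sup>2 - 2 * \<rho> + norm S = 0\<close>.
    This makes the ball of radius \<open>\<rho>\<close> invariant under \<open>f\<close>; being
    below 1, \<open>\<rho>\<close> is also the contraction constant.\<close>
  define \<rho> where "\<rho> = 1 - sqrt (1 - norm S)"
  have \<rho>: "0 \<le> \<rho>" "\<rho> < 1" and \<rho>2: "norm S + \<rho>\<^sup>2 = 2 * \<rho>"
    using S(2) by (auto simp: \<rho>_def power2_eq_square algebra_simps)
  define X where "X = {k. norm k \<le> \<rho>} \<inter> {k. sa k} \<inter> (\<Inter>B\<in>{B. B * S = S * B}. {k. B * k = k * B})"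
  define f where "f k = (1/2) *\<^sub>R (S + k * k)" for k
  have "closed {k::'h bop. norm k \<le> \<rho>}"
    by (intro closed_Collect_le continuous_intros)
  moreover have "closed {k. B * k = k * B}" for B :: "'h bop"
    by (intro closed_Collect_eq continuous_intros)
  ultimately have "closed X"
    unfolding X_def by (intro closed_Int closed_sa closed_INT) auto
  then have "complete X" by (simp add: complete_eq_closed)
  moreover have "0 \<in> X"
    unfolding X_def by (intro IntI CollectI INT_I) (use \<rho> adjp_intros(1) in simp_all)
  then have "X \<noteq> {}" by (metis empty_iff)
  moreover have "f ` X \<subseteq> X"
  proof (rule image_subsetI)
    fix k assume "k \<in> X"
    then have k: "norm k \<le> \<rho>" "sa k" "\<And>B. B * S = S * B \<Longrightarrow> B * k = k * B"
      unfolding X_def by blast+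
    have "norm (k * k) \<le> \<rho>\<^sup>2"
      using k(1) norm_mult_ineq[of k k] mult_mono[of "norm k" \<rho> "norm k" \<rho>] \<rho> by (simp add: power2_eq_square)
    then have "norm (S + k * k) \<le> 2 * \<rho>"
      using norm_triangle_ineq[of S "k * k"] \<rho>2 by linarith
    then have "norm (f k) \<le> \<rho>" by (simp add: f_def)
    moreover have "sa (f k)" unfolding f_def
      by (intro adjp_intros S k)
    moreover have "B * f k = f k * B" if "B * S = S * B" for B
    proof -
      have "B * (k * k) = k * k * B" by (intro commute_mult k(3) that)
      then show ?thesis using that by (simp add: f_def distrib_left distrib_right)
    qed
    ultimately show "f k \<in> X" unfolding X_def by blast
  qed
  moreover have "dist (f k) (f l) \<le> \<rho> * dist k l" if "k \<in> X" "l \<in> X" for k l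
  proof -
    have "f k - f l = (1/2) *\<^sub>R (k * (k - l) + (k - l) * l)"
      by (simp add: f_def algebra_simps)
    also have "norm \<dots> \<le> (1/2) * (norm k * norm (k - l) + norm (k - l) * norm l)"
      using norm_triangle_ineq[of "k * (k - l)" "(k - l) * l"] norm_mult_ineq[of k "k - l"] norm_mult_ineq[of "k - l" l]
      by simp
    also have "\<dots> \<le> (1/2) * (\<rho> * norm (k - l) + norm (k - l) * \<rho>)"
      using that unfolding X_def by (intro mult_left_mono add_mono mult_right_mono) simp_all
    finally show ?thesis by (simp add: dist_norm)
  qed
  ultimately obtain k where k: "k \<in> X" "f k = k"
    using Banach_fix[of X \<rho> f] \<rho> by blast
  have "2 *\<^sub>R k = S + k * k"
    using k(2) by (metis f_def scaleR_half_double scaleR_2 scaleR_scaleR scaleR_add_right)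
  then have sq: "(1 - k) * (1 - k) = 1 - S"
    by (simp add: algebra_simps scaleR_2)
  have k': "sa k" "\<And>B. B * S = S * B \<Longrightarrow> B * k = k * B" using k unfolding X_def by blast+
  show thesis
  proof (rule that[OF _ sq])
    show "sa (1 - k)" by (intro adjp_intros k')
    show "B * (1 - k) = (1 - k) * B" if "B * S = S * B" for B
      by (simp only: k'(2)[OF that] left_diff_distrib right_diff_distrib mult_1 mult_1_right)
  qed
qed

text \<open>After scaling to \<open>Q\<close>, a root \<open>G\<close> of \<open>1 - Q * Q\<close>
  satisfies \<open>G * G + Q * Q = 1\<close>, so \<open>G\<close> is a contraction by
  \<open>norm_sa_sq_commuting\<close>, and hence so is its square.\<close>

lemma norm_minus_square:
  assumes S: "sa S" "norm S < r"
  shows "norm (r\<^sup>2 *\<^sub>R 1 - S * S) \<le> r\<^sup>2"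
proof -
  have r: "r > 0" using S(2) norm_ge_zero[of S] by linarith
  define Q where "Q = inverse r *\<^sub>R S"
  have Q: "sa Q" "norm Q < 1" using S r by (auto simp: Q_def field_simps intro: adjp_intros)
  have "norm (Q * Q) < 1"
    using norm_mult_ineq[of Q Q] Q(2) mult_left_le[of "norm Q" "norm Q"] by simp
  then obtain G where G: "sa G" "G * G = 1 - Q * Q" "\<And>B. B * (Q * Q) = Q * Q * B \<Longrightarrow> B * G = G * B"
    using sqrt_one_minus[of "Q * Q"] adjp_intros(5)[OF Q(1) Q(1)] by blast
  have "G * Q = Q * G" using G(3)[of Q] by (simp add: mult.assoc)
  then have "(norm (app G x))\<^sup>2 \<le> (norm x)\<^sup>2" for x
    using norm_sa_sq_commuting[OF G(1) Q(1), of x] G(2) by (simp add: app_simps norm_ip_self)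
  then have "norm G \<le> 1"
    by (intro norm_bop_le) (simp_all add: power2_le_iff_abs_le)
  then have "norm (1 - Q * Q) \<le> 1"
    using norm_mult_ineq[of G G] mult_mono[of "norm G" 1 "norm G" 1] G(2) by simp
  then have "r\<^sup>2 * norm (1 - Q * Q) \<le> r\<^sup>2" using mult_left_le r by fastforce
  moreover have "r\<^sup>2 *\<^sub>R 1 - S * S = r\<^sup>2 *\<^sub>R (1 - Q * Q)"
    using r by (simp add: Q_def algebra_simps power2_eq_square)
  ultimately show ?thesis by simp
qed

text \<open>The norm characterization of positive elements of a C*-algebra. In this form sums need
  only the triangle inequality.\<close>

definition bpos :: "'h bop \<Rightarrow> bool" where
  "bpos S \<longleftrightarrow> sa S \<and> (\<exists>r\<ge>0. norm (r *\<^sub>R 1 - S) \<le> r)"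

lemma bpos_square:
  assumes "sa S"
  shows "bpos (S * S)"
proof -
  have "norm (((norm S + 1)\<^sup>2) *\<^sub>R 1 - S * S) \<le> (norm S + 1)\<^sup>2"
    by (rule norm_minus_square[OF assms]) simp
  then show ?thesis
    unfolding bpos_def using adjp_intros(5)[OF assms assms] by (metis zero_le_power2)
qed

lemma bpos_add:
  assumes "bpos S" "bpos R"
  shows "bpos (S + R)"
proof -
  obtain r s where "r \<ge> 0" "norm (r *\<^sub>R 1 - S) \<le> r" "s \<ge> 0" "norm (s *\<^sub>R 1 - R) \<le> s"
    using assms by (auto simp: bpos_def)
  moreover have *: "(r + s) *\<^sub>R 1 - (S + R) = (r *\<^sub>R 1 - S) + (s *\<^sub>R 1 - R)"
    by (simp add: algebra_simps)
  ultimately have "r + s \<ge> 0" "norm ((r + s) *\<^sub>R 1 - (S + R)) \<le> r + s"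
    unfolding * using norm_triangle_ineq[of "r *\<^sub>R 1 - S" "s *\<^sub>R 1 - R"] by linarith+
  then show ?thesis
    using assms unfolding bpos_def by (blast intro: adjp_intros)
qed

text \<open>The operator is \<open>(r + \<mu>) *\<^sub>R 1\<close> minus one of norm at most
  \<open>r\<close>.\<close>

lemma bpos_inv_op:
  assumes "bpos S" "\<mu> > 0"
  shows "inv_op (\<mu> *\<^sub>R 1 + S)"
proof -
  obtain r where "r \<ge> 0" "norm (r *\<^sub>R 1 - S) \<le> r" using assms by (auto simp: bpos_def)
  then have "inv_op ((r + \<mu>) *\<^sub>R 1 - (r *\<^sub>R 1 - S))"
    using assms by (intro inv_op_scaleR_minus adjp_intros) (auto simp: bpos_def)
  then show ?thesis by (simp add: algebra_simps)
qed

text \<open>Multiplication by \<open>B\<close>, which is \<open>cnj z *\<^sub>C 1 - S\<close>, gives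
  a positive multiple of 1 plus the square \<open>Q * Q\<close>.\<close>

lemma inv_op_nonreal:
  assumes S: "sa S" and z: "Im z \<noteq> 0"
  shows "inv_op (z *\<^sub>C 1 - S)"
proof -
  define Q where "Q = S - Re z *\<^sub>R 1"
  have Q: "sa Q" unfolding Q_def by (intro adjp_intros S)
  have A: "z *\<^sub>C 1 - S = (\<i> * Im z) *\<^sub>C 1 - Q"
    by (subst complex_eq[of z]) (simp add: Q_def scaleC_add_left scaleC_of_real[symmetric])
  define B where "B = (- (\<i> * Im z)) *\<^sub>C 1 - Q"
  have AB: "(z *\<^sub>C 1 - S) * B = (Im z)\<^sup>2 *\<^sub>R 1 + Q * Q" "B * (z *\<^sub>C 1 - S) = (Im z)\<^sup>2 *\<^sub>R 1 + Q * Q"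
    unfolding A B_def
    by (simp_all add: algebra_simps mult_scaleC_bop scaleC_scaleC scaleC_minus_left scaleC_diff_right
        scaleC_minus_right scaleC_of_real[symmetric] power2_eq_square)
  have inv: "inv_op ((z *\<^sub>C 1 - S) * B)"
    unfolding AB by (intro bpos_inv_op bpos_square Q) (use z in simp)
  have B: "adjp B (cnj (- (\<i> * Im z)) *\<^sub>C 1 - Q)"
    unfolding B_def by (rule adjp_intros(4)[OF adjp_intros(8)[OF adjp_intros(2)] Q])
  show ?thesis by (rule inv_op_factor[OF inv _ B]) (simp only: AB)
qed

lemma commute_inverse:
  fixes B R S :: "'h bop"
  assumes "R * B = 1" "B * R = 1" "S * B = B * S"
  shows "S * R = R * S"
proof -
  have "S * R = R * B * (S * R)" using assms(1) by simp
  also have "\<dots> = R * (B * S) * R" by (simp only: mult.assoc)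
  also have "\<dots> = R * S * (B * R)" by (simp only: assms(3)[symmetric] mult.assoc)
  finally show ?thesis using assms(2) by simp
qed

text \<open>An inverse \<open>R\<close> of \<open>B\<close> would leave room below 1: ideally
  \<open>Q * Q = (1 - \<delta> *\<^sub>R R) * B\<close>, which is
  \<open>B - \<delta> *\<^sub>R 1\<close>, so that
  \<open>S * S + Q * Q = (1 - \<delta>) *\<^sub>R 1\<close> and the norm of \<open>S\<close> drops
  below 1. But \<open>sqrt_one_minus\<close> needs a norm strictly below 1, and for
  \<open>S * S\<close> only the bound 1 is known. So \<open>B + \<epsilon> *\<^sub>R 1\<close> takes
  the place of \<open>B\<close>, at the cost of an error term in \<open>R\<close>.\<close>

lemma norm_one_not_inv_op:
  assumes S: "sa S" "norm S = 1"
  shows "\<not> inv_op (1 - S * S)"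
proof
  define B where "B = 1 - S * S"
  assume "inv_op (1 - S * S)"
  then obtain R where R: "sa R" "R * B = 1" "B * R = 1"
    using inv_op_sa[of B] S by (auto simp: B_def intro: adjp_intros)
  \<comment> \<open>Small enough that \<open>1 - \<delta> *\<^sub>R R\<close> has a root and that
    \<open>4 * (\<delta> * norm R)\<close> stays below 1, the 4 being the constant of
    \<open>norm_ip_le\<close>.\<close>
  define \<delta> where "\<delta> = 1 / (4 * norm R + 4)"
  have \<delta>: "0 < \<delta>" "\<delta> * norm R < 1/4" "\<delta> < 1"
    using add_nonneg_pos[of "4 * norm R" 4] add_nonneg_pos[of "4 * norm R" 3] by (simp_all add: \<delta>_def divide_simps)
  \<comment> \<open>The error term costs at most one further \<open>\<epsilon>\<close>, and
    \<open>1 + \<epsilon> - \<delta> + \<epsilon>\<close> is then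
    \<open>1 - \<delta>/2\<close>.\<close>
  define \<epsilon> where "\<epsilon> = \<delta> / 4"
  have \<epsilon>: "0 < \<epsilon>" "\<epsilon> < 1" using \<delta> by (auto simp: \<epsilon>_def)
  have comm: "S * R = R * S"
    by (rule commute_inverse[OF R(2,3)]) (simp add: B_def algebra_simps mult.assoc)
  obtain P where P: "sa P" "P * P = 1 - \<delta> *\<^sub>R R" "\<And>X. X * R = R * X \<Longrightarrow> X * P = P * X"
  proof -
    have "sa (\<delta> *\<^sub>R R)" "norm (\<delta> *\<^sub>R R) < 1" using \<delta> R by (auto intro: adjp_intros)
    then obtain P where P: "sa P" "P * P = 1 - \<delta> *\<^sub>R R"
        "\<And>X. X * \<delta> *\<^sub>R R = \<delta> *\<^sub>R R * X \<Longrightarrow> X * P = P * X"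
      using sqrt_one_minus by blast
    show thesis by (rule that[OF P(1,2)], rule P(3)) simp
  qed
  define s where "s = 1 + \<epsilon>"
  obtain G where G: "sa G" "G * G = 1 - inverse s *\<^sub>R (S * S)" "\<And>X. X * (S * S) = (S * S) * X \<Longrightarrow> X * G = G * X"
  proof -
    have "norm (S * S) \<le> 1" using norm_mult_ineq[of S S] S(2) by simp
    then have "norm (inverse s *\<^sub>R (S * S)) < 1" using \<epsilon> by (simp add: s_def field_simps)
    moreover have "sa (inverse s *\<^sub>R (S * S))" using S by (intro adjp_intros)
    ultimately obtain G where G: "sa G" "G * G = 1 - inverse s *\<^sub>R (S * S)"
        "\<And>X. X * inverse s *\<^sub>R (S * S) = inverse s *\<^sub>R (S * S) * X \<Longrightarrow> X * G = G * X"
      using sqrt_one_minus by blast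
    show thesis by (rule that[OF G(1,2)], rule G(3)) simp
  qed
  have SP: "S * P = P * S" using P(3) comm by blast
  then have "P * (S * S) = S * S * P" by (intro commute_mult) simp_all
  then have PG: "P * G = G * P" by (rule G(3))
  have SG: "S * G = G * S" by (rule G(3)) (simp add: mult.assoc)
  define Q where "Q = sqrt s *\<^sub>R (P * G)"
  have Q: "sa Q" unfolding Q_def using adjp_intros(5)[OF P(1) G(1)] PG by (auto intro: adjp_intros)
  have SQ: "S * Q = Q * S" using commute_mult[OF SP SG] by (simp add: Q_def)
  have "s *\<^sub>R (G * G) = B + \<epsilon> *\<^sub>R 1"
    using \<epsilon> by (simp add: G(2) B_def s_def scaleR_diff_right scaleR_left_distrib)
  moreover have "Q * Q = (P * P) * s *\<^sub>R (G * G)"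
    using \<epsilon> commute_square[OF PG] by (simp add: Q_def s_def)
  ultimately have "Q * Q = (1 - \<delta> *\<^sub>R R) * (B + \<epsilon> *\<^sub>R 1)" by (simp add: P(2))
  also have "\<dots> = B + (\<epsilon> - \<delta>) *\<^sub>R 1 - (\<delta> * \<epsilon>) *\<^sub>R R"
    using R by (simp add: algebra_simps)
  finally have sum: "S * S + Q * Q = (1 + \<epsilon> - \<delta>) *\<^sub>R 1 - (\<delta> * \<epsilon>) *\<^sub>R R"
    by (simp add: B_def algebra_simps)
  have "(norm (app S x))\<^sup>2 \<le> (1 - \<delta>/2) * (norm x)\<^sup>2" for x
  proof -
    have "(norm (app S x))\<^sup>2 \<le> norm (ip x (app (S * S + Q * Q) x))"
      by (rule norm_sa_sq_commuting[OF S(1) Q SQ])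
    also have "\<dots> = norm ((1 + \<epsilon> - \<delta>) *\<^sub>R ip x x - (\<delta> * \<epsilon>) *\<^sub>R ip x (app R x))"
      by (simp add: sum app_simps ip_simps)
    also have "\<dots> \<le> (1 + \<epsilon> - \<delta>) * (norm x)\<^sup>2 + (\<delta> * \<epsilon>) * norm (ip x (app R x))"
      using norm_triangle_ineq4[of "(1 + \<epsilon> - \<delta>) *\<^sub>R ip x x" "(\<delta> * \<epsilon>) *\<^sub>R ip x (app R x)"] \<delta> \<epsilon>
      by (simp add: norm_ip_self)
    also have "norm (ip x (app R x)) \<le> 4 * norm x * (norm R * norm x)"
      by (rule order_trans[OF norm_ip_le]) (intro mult_left_mono norm_app_le; simp)
    also have "(\<delta> * \<epsilon>) * (4 * norm x * (norm R * norm x)) = (4 * (\<delta> * norm R)) * \<epsilon> * (norm x)\<^sup>2"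
      by (simp add: power2_eq_square)
    also have "\<dots> \<le> 1 * \<epsilon> * (norm x)\<^sup>2"
      using \<delta> \<epsilon> by (intro mult_right_mono) auto
    finally show ?thesis
      using \<delta> \<epsilon> by (simp add: \<epsilon>_def algebra_simps)
  qed
  moreover have "(sqrt (1 - \<delta>/2) * norm x)\<^sup>2 = (1 - \<delta>/2) * (norm x)\<^sup>2" for x :: 'h
    using \<delta>(3) by (simp add: power_mult_distrib)
  moreover have "0 \<le> sqrt (1 - \<delta>/2) * norm x" for x :: 'h
    using \<delta>(3) by simp
  ultimately have "norm (app S x) \<le> sqrt (1 - \<delta>/2) * norm x" for x
    by (metis power2_le_imp_le)
  then have "norm S \<le> sqrt (1 - \<delta>/2)"
    by (intro norm_bop_le) (use \<delta> in auto)
  also have "\<dots> < 1" using \<delta> by simp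
  finally show False using S(2) by simp
qed

text \<open>For the normalized operator \<open>Q\<close>, invertibility of both factors of
  \<open>1 - Q * Q = (1 - Q) * (1 + Q)\<close> would contradict
  \<open>norm_one_not_inv_op\<close>.\<close>

lemma norm_attained:
  assumes S: "sa S" "S \<noteq> 0"
  shows "\<not> inv_op (norm S *\<^sub>R 1 - S) \<or> \<not> inv_op (norm S *\<^sub>R 1 + S)"
proof (rule ccontr)
  define Q where "Q = inverse (norm S) *\<^sub>R S"
  assume "\<not> ?thesis"
  moreover have "norm S *\<^sub>R 1 - S = norm S *\<^sub>R (1 - Q)" "norm S *\<^sub>R 1 + S = norm S *\<^sub>R (1 + Q)"
    using S(2) by (simp_all add: Q_def algebra_simps)
  ultimately have "inv_op (1 - Q)" "inv_op (1 + Q)"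
    using S(2) by (simp_all add: inv_op_scaleR_iff)
  then have "inv_op ((1 - Q) * (1 + Q))" by (rule inv_op_mult)
  moreover have "(1 - Q) * (1 + Q) = 1 - Q * Q" by (simp add: algebra_simps)
  moreover have "sa Q" "norm Q = 1" using S by (auto simp: Q_def intro: adjp_intros)
  ultimately show False using norm_one_not_inv_op by simp
qed

section \<open>The real spectrum and the norm of polynomials in an operator\<close>

definition rspec :: "'h bop \<Rightarrow> real set" where
  "rspec S = {t. \<not> inv_op (t *\<^sub>R 1 - S)}"

lemma op_spectrum_app:
  shows "op_spectrum ip (app S) = {z. \<not> inv_op (z *\<^sub>C 1 - S)}"
proof -
  have "(\<exists>f\<in>adjointable ip ip. f \<circ> (\<lambda>x. z *\<^sub>C x - app S x) = id \<and> (\<lambda>x. z *\<^sub>C x - app S x) \<circ> f = id)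
    \<longleftrightarrow> inv_op (z *\<^sub>C 1 - S)" (is "?l = ?r") for z
  proof -
    have zS: "(\<lambda>x. z *\<^sub>C x - app S x) = app (z *\<^sub>C 1 - S)"
      by (simp add: app_simps app_scaleC_left fun_eq_iff)
    show ?thesis
    proof
      assume ?l
      then obtain R R' where "adjp R R'" "app R \<circ> app (z *\<^sub>C 1 - S) = id" "app (z *\<^sub>C 1 - S) \<circ> app R = id"
        using adjointable_adjp unfolding zS by metis
      then have "R * (z *\<^sub>C 1 - S) = 1" "(z *\<^sub>C 1 - S) * R = 1"
        by (auto simp: fun_eq_iff app_simps intro!: bop_eqI)
      with \<open>adjp R R'\<close> show ?r unfolding inv_op_def by blast
    next
      assume ?r
      then obtain R R' where "adjp R R'" "R * (z *\<^sub>C 1 - S) = 1" "(z *\<^sub>C 1 - S) * R = 1"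
        unfolding inv_op_def by blast
      then have "app R \<in> adjointable ip ip" "app R \<circ> app (z *\<^sub>C 1 - S) = id" "app (z *\<^sub>C 1 - S) \<circ> app R = id"
        by (auto simp: adjointable_def adjp_def fun_eq_iff app_simps(6)[symmetric] app_simps(2))
      then show ?l unfolding zS by blast
    qed
  qed
  then show ?thesis unfolding op_spectrum_def by blast
qed

lemma op_spectrum_sa:
  assumes "sa S"
  shows "op_spectrum ip (app S) = complex_of_real ` rspec S"
proof -
  have "z \<in> complex_of_real ` rspec S" if "\<not> inv_op (z *\<^sub>C 1 - S)" for z
  proof -
    have "z = complex_of_real (Re z)"
      using inv_op_nonreal[OF assms, of z] that complex_eq_iff by auto
    moreover from this have "Re z \<in> rspec S"
      using that by (simp add: rspec_def scaleC_of_real[symmetric])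
    ultimately show ?thesis by blast
  qed
  then show ?thesis
    by (auto simp: op_spectrum_app rspec_def scaleC_of_real)
qed

lemma compact_rspec:
  assumes S: "sa S"
  shows "compact (rspec S)"
proof -
  have "rspec S \<subseteq> {- norm S..norm S}"
    using inv_op_scaleR_minus[OF S] by (force simp: rspec_def abs_le_iff)
  moreover have "closed (rspec S)"
    unfolding closed_def open_dist
  proof safe
    fix t assume "t \<notin> rspec S"
    then have inv: "inv_op (t *\<^sub>R 1 - S)" by (simp add: rspec_def)
    then obtain R where R: "sa R" "R * (t *\<^sub>R 1 - S) = 1" "(t *\<^sub>R 1 - S) * R = 1"
      using inv_op_sa S by (metis adjp_intros(2,4,7))
    have "s \<in> - rspec S" if "dist s t < inverse (norm R + 1)" for s
    proof -
      have "\<bar>t - s\<bar> * (norm R + 1) < 1"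
        using that norm_ge_zero[of R] by (simp add: dist_real_def abs_minus_commute field_simps)
      then have "\<bar>t - s\<bar> * norm R < 1" by (simp add: distrib_left)
      \<comment> \<open>The second factor is a small perturbation of the identity, and the product
        is \<open>s *\<^sub>R 1 - S\<close>; so invertibility persists near
        \<open>t\<close>.\<close>
      then have "inv_op ((t *\<^sub>R 1 - S) * (1 - (t - s) *\<^sub>R R))"
        using R by (intro inv_op_mult[OF inv] inv_op_one_minus[where E' = "(t - s) *\<^sub>R R"] adjp_intros) auto
      moreover have "(t *\<^sub>R 1 - S) * (1 - (t - s) *\<^sub>R R) = s *\<^sub>R 1 - S"
        using R(3) by (simp only: right_diff_distrib mult_1_right mult_scaleR_right) (simp add: algebra_simps)
      ultimately show ?thesis by (simp add: rspec_def)
    qed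
    then show "\<exists>e>0. \<forall>s. dist s t < e \<longrightarrow> s \<in> - rspec S"
      by (intro exI[of _ "inverse (norm R + 1)"]) (simp add: add_nonneg_pos)
  qed
  ultimately show ?thesis
    using compact_eq_bounded_closed bounded_subset bounded_closed_interval by blast
qed

text \<open>Splitting \<open>p\<close> into linear factors over the complex numbers gives the half
  of the spectral mapping theorem that the norm bound for polynomials uses.\<close>

lemma poly_op_inv_op:
  assumes "sa S" "p \<noteq> 0" "\<And>z. poly p z = 0 \<Longrightarrow> inv_op (z *\<^sub>C 1 - S)"
  shows "inv_op (poly_op p S)"
  using assms(2,3)
proof (induction "degree p" arbitrary: p)
  case 0
  then obtain a where "p = [:a:]" by (metis degree_eq_zeroE)
  then show ?case using 0 inv_op_scaleC[OF inv_op_one] by (simp add: poly_op_pCons)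
next
  case (Suc n)
  have "\<not> constant (poly p)" using Suc(2) by (simp add: constant_degree)
  then obtain z where z: "poly p z = 0" using fundamental_theorem_of_algebra by blast
  then obtain q where q: "p = [:- z, 1:] * q" by (auto simp: poly_eq_0_iff_dvd)
  with Suc.prems have "q \<noteq> 0" by auto
  have "degree p = Suc (degree q)"
    unfolding q using \<open>q \<noteq> 0\<close> by (subst degree_mult_eq) auto
  then have "inv_op (poly_op q S)"
    using Suc.prems Suc.hyps q \<open>q \<noteq> 0\<close> by auto
  moreover have "poly_op [:- z, 1:] S = (- 1) *\<^sub>C (z *\<^sub>C 1 - S)"
    by (simp add: poly_op_pCons scaleC_minus_left)
  then have "inv_op (poly_op [:- z, 1:] S)"
    using inv_op_scaleC[OF Suc.prems(2)[OF z], of "- 1"] by simp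
  ultimately show ?case
    unfolding q poly_op_mult by (intro inv_op_mult)
qed

lemma sa_rpoly_op: "sa S \<Longrightarrow> sa (rpoly_op p S)"
proof (induction p)
  case (pCons a p)
  have "rpoly_op p S * S = S * rpoly_op p S"
    using rpoly_op_simps(5)[of p "[:0, 1:]" S] rpoly_op_simps(5)[of "[:0, 1:]" p S]
    by (simp add: rpoly_op_simps mult.commute)
  with pCons show ?case
    using adjp_intros(5)[of S S "rpoly_op p S" "rpoly_op p S"]
    by (auto simp: rpoly_op_simps intro: adjp_intros)
qed (simp add: rpoly_op_simps adjp_intros)

text \<open>Serves the zero polynomial in \<open>norm_rpoly_op_le\<close>, for which a root in the
  spectrum is demanded.\<close>

lemma rspec_nonempty:
  assumes S: "sa S" and "(1::'h bop) \<noteq> 0"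
  shows "rspec S \<noteq> {}"
proof (cases "S = 0")
  case True
  have "\<not> inv_op (0 *\<^sub>R 1 - S)" using True assms(2) by (auto simp: inv_op_def)
  then have "0 \<in> rspec S" by (simp add: rspec_def)
  then show ?thesis by blast
next
  case False
  have "inv_op (norm S *\<^sub>R 1 + S) \<longleftrightarrow> inv_op ((- norm S) *\<^sub>R 1 - S)"
    using inv_op_scaleR_iff[of "- 1" "norm S *\<^sub>R 1 + S"] by simp
  with norm_attained[OF S False] have "norm S \<in> rspec S \<or> - norm S \<in> rspec S"
    unfolding rspec_def by blast
  then show ?thesis by blast
qed

text \<open>By \<open>norm_attained\<close>, subtracting or adding \<open>rpoly_op p S\<close> to
  \<open>N *\<^sub>R 1\<close> destroys invertibility. Hence \<open>[:N:] - p\<close> or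
  \<open>[:N:] + p\<close> has a root in the spectrum, and \<open>N\<close> is a value of the
  modulus of \<open>p\<close> there.\<close>

lemma norm_rpoly_op_le:
  assumes S: "sa S" and c: "c \<ge> 0" "\<And>t. t \<in> rspec S \<Longrightarrow> \<bar>poly p t\<bar> \<le> c"
  shows "norm (rpoly_op p S) \<le> c"
proof (cases "rpoly_op p S = 0")
  case False
  define N where "N = norm (rpoly_op p S)"
  have N: "N > 0" using False by (simp add: N_def)
  have root: "\<exists>t\<in>rspec S. poly q t = 0" if q: "\<not> inv_op (rpoly_op q S)" for q
  proof (cases "q = 0")
    case True
    have "(1::'h bop) \<noteq> 0" using False by (metis mult_zero_left mult_1)
    with rspec_nonempty[OF S] True show ?thesis by auto
  next
    case False
    have "cpoly q \<noteq> 0" using False by (metis coeff_0 coeff_map_poly of_real_0 of_real_eq_0_iff poly_eqI)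
    then obtain z where z: "poly (cpoly q) z = 0" "\<not> inv_op (z *\<^sub>C 1 - S)"
      using q poly_op_inv_op[OF S] unfolding rpoly_op_def by blast
    then obtain t where t: "z = complex_of_real t" "t \<in> rspec S"
      using op_spectrum_sa[OF S] op_spectrum_app[of S] by blast
    then show ?thesis using z poly_cpoly[of q t] by auto
  qed
  have "rpoly_op ([:N:] - p) S = N *\<^sub>R 1 - rpoly_op p S" "rpoly_op ([:N:] + p) S = N *\<^sub>R 1 + rpoly_op p S"
    by (simp_all only: rpoly_op_simps mult_zero_right add_0_right)
  then have "\<not> inv_op (rpoly_op ([:N:] - p) S) \<or> \<not> inv_op (rpoly_op ([:N:] + p) S)"
    using norm_attained[OF sa_rpoly_op[OF S] False] by (simp add: N_def)
  then obtain t where "t \<in> rspec S" "N - poly p t = 0 \<or> N + poly p t = 0"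
    using root by fastforce
  then have "N \<le> c" using c(2)[of t] N by auto
  then show ?thesis by (simp add: N_def)
qed (use c in simp)

end

section \<open>Continuous functional calculus\<close>

lemma real_poly_approx:
  fixes f :: "real \<Rightarrow> real"
  assumes "compact K" "continuous_on K f" "0 < e"
  obtains p where "\<And>t. t \<in> K \<Longrightarrow> \<bar>f t - poly p t\<bar> < e"
proof -
  obtain g where g: "real_polynomial_function g" "\<And>t. t \<in> K \<Longrightarrow> \<bar>f t - g t\<bar> < e"
    using Stone_Weierstrass_real_polynomial_function[OF assms] by blast
  then obtain a n where "g = (\<lambda>x. \<Sum>i\<le>n. a i * x ^ i)"
    using real_polynomial_function_iff_sum by blast
  then have "g = poly (\<Sum>i\<le>n. monom (a i) i)"
    by (simp add: poly_sum poly_monom fun_eq_iff)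
  with g(2) that show thesis by blast
qed

lemma LIMSEQ_scaled_inverse: "(\<lambda>n. c * inverse (real (Suc n))) \<longlonglongrightarrow> 0"
  using tendsto_mult_right_zero[OF LIMSEQ_inverse_real_of_nat, of c] by simp

context hilbert_module
begin

text \<open>Quantifying over all polynomial approximants makes the value independent of a chosen
  sequence, and the instance \<open>p = 0\<close> is already the norm bound.\<close>

definition is_fc :: "'h bop \<Rightarrow> (real \<Rightarrow> real) \<Rightarrow> 'h bop \<Rightarrow> bool" where
  "is_fc S f L \<longleftrightarrow>
    (\<forall>p c. 0 \<le> c \<longrightarrow> (\<forall>t\<in>rspec S. \<bar>f t - poly p t\<bar> \<le> c) \<longrightarrow> norm (L - rpoly_op p S) \<le> c)"

definition fc :: "'h bop \<Rightarrow> (real \<Rightarrow> real) \<Rightarrow> 'h bop" where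
  "fc S f = (THE L. is_fc S f L)"

lemma approx_seq:
  assumes "sa S" "continuous_on (rspec S) f"
  obtains p where "\<And>n t. t \<in> rspec S \<Longrightarrow> \<bar>f t - poly (p n) t\<bar> \<le> inverse (real (Suc n))"
proof -
  have "\<forall>n. \<exists>p. \<forall>t\<in>rspec S. \<bar>f t - poly p t\<bar> \<le> inverse (real (Suc n))"
  proof
    fix n
    have "0 < inverse (real (Suc n))" by simp
    then obtain p where "\<And>t. t \<in> rspec S \<Longrightarrow> \<bar>f t - poly p t\<bar> < inverse (real (Suc n))"
      using real_poly_approx[OF compact_rspec[OF assms(1)] assms(2)] by blast
    then show "\<exists>p. \<forall>t\<in>rspec S. \<bar>f t - poly p t\<bar> \<le> inverse (real (Suc n))"
      by (intro exI[of _ p]) (simp add: less_imp_le)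
  qed
  from choice[OF this] show thesis using that by blast
qed

lemma is_fc_LIMSEQ:
  assumes "is_fc S f L" "\<And>n t. t \<in> rspec S \<Longrightarrow> \<bar>f t - poly (p n) t\<bar> \<le> e n" "\<And>n. 0 \<le> e n" "e \<longlonglongrightarrow> 0"
  shows "(\<lambda>n. rpoly_op (p n) S) \<longlonglongrightarrow> L"
proof -
  have "norm (rpoly_op (p n) S - L) \<le> e n" for n
    using assms(1-3) unfolding is_fc_def by (metis norm_minus_commute)
  then have "(\<lambda>n. rpoly_op (p n) S - L) \<longlonglongrightarrow> 0"
    by (intro Lim_null_comparison[OF _ assms(4)]) simp
  then show ?thesis by (simp add: LIM_zero_iff)
qed

lemma is_fc_fc:
  assumes S: "sa S" and f: "continuous_on (rspec S) f"
  shows "is_fc S f (fc S f)"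
proof -
  define e where "e n = inverse (real (Suc n))" for n
  have e: "0 \<le> e n" "e \<longlonglongrightarrow> 0" for n
    using LIMSEQ_inverse_real_of_nat by (simp_all add: e_def[abs_def])
  obtain p where p: "\<And>n t. t \<in> rspec S \<Longrightarrow> \<bar>f t - poly (p n) t\<bar> \<le> e n"
    using approx_seq[OF S f] unfolding e_def by blast
  have diff: "norm (rpoly_op (p n) S - rpoly_op q S) \<le> e n + c"
    if "0 \<le> c" "\<And>t. t \<in> rspec S \<Longrightarrow> \<bar>f t - poly q t\<bar> \<le> c" for n q c
  proof -
    have "\<bar>poly (p n - q) t\<bar> \<le> e n + c" if t: "t \<in> rspec S" for t
      using p[OF t, of n] \<open>\<And>t. t \<in> rspec S \<Longrightarrow> \<bar>f t - poly q t\<bar> \<le> c\<close>[OF t] by simp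
    then show ?thesis
      using norm_rpoly_op_le[OF S, of "e n + c" "p n - q"] e(1) that(1) by (simp add: rpoly_op_simps)
  qed
  have "Cauchy (\<lambda>n. rpoly_op (p n) S)"
  proof (rule metric_CauchyI)
    fix r :: real assume "0 < r"
    then obtain N where N: "\<And>n. n \<ge> N \<Longrightarrow> e n < r / 2"
      using order_tendstoD(2)[OF e(2), of "r / 2"] by (auto simp: eventually_sequentially)
    have "dist (rpoly_op (p m) S) (rpoly_op (p n) S) < r" if "m \<ge> N" "n \<ge> N" for m n
      using diff[OF e(1) p, of m n] N[OF that(1)] N[OF that(2)] by (simp add: dist_norm)
    then show "\<exists>N. \<forall>m\<ge>N. \<forall>n\<ge>N. dist (rpoly_op (p m) S) (rpoly_op (p n) S) < r" by blast
  qed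
  then obtain L where L: "(\<lambda>n. rpoly_op (p n) S) \<longlonglongrightarrow> L"
    using Cauchy_convergent convergent_def by blast
  have "is_fc S f L"
    unfolding is_fc_def
  proof (intro allI impI)
    fix q c assume c: "0 \<le> c" "\<forall>t\<in>rspec S. \<bar>f t - poly q t\<bar> \<le> c"
    have "(\<lambda>n. norm (rpoly_op (p n) S - rpoly_op q S)) \<longlonglongrightarrow> norm (L - rpoly_op q S)"
      by (intro tendsto_intros L)
    moreover have "(\<lambda>n. e n + c) \<longlonglongrightarrow> 0 + c" by (intro tendsto_intros e)
    ultimately show "norm (L - rpoly_op q S) \<le> c"
      using LIMSEQ_le diff c by fastforce
  qed
  moreover have "L' = L" if "is_fc S f L'" for L'
    using LIMSEQ_unique[OF is_fc_LIMSEQ[OF that p e] L] .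
  ultimately show ?thesis unfolding fc_def by (metis theI)
qed

lemma fc_LIMSEQ:
  assumes "sa S" "continuous_on (rspec S) f"
    and "\<And>n t. t \<in> rspec S \<Longrightarrow> \<bar>f t - poly (p n) t\<bar> \<le> c * inverse (real (Suc n))" "0 \<le> c"
  shows "(\<lambda>n. rpoly_op (p n) S) \<longlonglongrightarrow> fc S f"
  using is_fc_LIMSEQ[OF is_fc_fc[OF assms(1,2)] assms(3)] assms(4) LIMSEQ_scaled_inverse by auto

lemma fc_norm_le:
  assumes "sa S" "continuous_on (rspec S) f" "0 \<le> c" "\<And>t. t \<in> rspec S \<Longrightarrow> \<bar>f t\<bar> \<le> c"
  shows "norm (fc S f) \<le> c"
  using is_fc_fc[OF assms(1,2)] assms(3,4) unfolding is_fc_def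
  by (metis diff_zero poly_0 rpoly_op_simps(1))

lemma fc_cong:
  assumes "\<And>t. t \<in> rspec S \<Longrightarrow> f t = g t"
  shows "fc S f = fc S g"
proof -
  have "is_fc S f = is_fc S g" using assms by (simp add: is_fc_def fun_eq_iff)
  then show ?thesis by (simp add: fc_def)
qed

lemma fc_poly:
  assumes "sa S"
  shows "fc S (poly p) = rpoly_op p S"
  using is_fc_fc[OF assms, of "poly p"] continuous_on_poly[OF continuous_on_id, of _ p]
  unfolding is_fc_def by (metis abs_zero diff_self eq_iff_diff_eq_0 norm_le_zero_iff order_refl)

lemma fc_const: "sa S \<Longrightarrow> fc S (\<lambda>t. r) = r *\<^sub>R 1"
  using fc_poly[of S "[:r:]"] fc_cong[of S "poly [:r:]" "\<lambda>t. r"] by (simp add: rpoly_op_simps)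

lemma fc_id: "sa S \<Longrightarrow> fc S (\<lambda>t. t) = S"
  using fc_poly[of S "[:0, 1:]"] fc_cong[of S "poly [:0, 1:]" "\<lambda>t. t"] by (simp add: rpoly_op_simps)

lemma sa_fc:
  assumes "sa S" "continuous_on (rspec S) f"
  shows "sa (fc S f)"
proof -
  obtain p where "\<And>n t. t \<in> rspec S \<Longrightarrow> \<bar>f t - poly (p n) t\<bar> \<le> inverse (real (Suc n))"
    using approx_seq[OF assms] by blast
  then have "(\<lambda>n. rpoly_op (p n) S) \<longlonglongrightarrow> fc S f"
    by (intro fc_LIMSEQ[OF assms, where c = 1]) auto
  from adjp_limit[OF this this] show ?thesis using sa_rpoly_op[OF assms(1)] by blast
qed

lemma fc_add:
  assumes S: "sa S" and f: "continuous_on (rspec S) f" and g: "continuous_on (rspec S) g"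
  shows "fc S (\<lambda>t. f t + g t) = fc S f + fc S g"
proof -
  obtain p where p: "\<And>n t. t \<in> rspec S \<Longrightarrow> \<bar>f t - poly (p n) t\<bar> \<le> inverse (real (Suc n))"
    using approx_seq[OF S f] by blast
  obtain q where q: "\<And>n t. t \<in> rspec S \<Longrightarrow> \<bar>g t - poly (q n) t\<bar> \<le> inverse (real (Suc n))"
    using approx_seq[OF S g] by blast
  have "(\<lambda>n. rpoly_op (p n) S) \<longlonglongrightarrow> fc S f" "(\<lambda>n. rpoly_op (q n) S) \<longlonglongrightarrow> fc S g"
    using p q by (intro fc_LIMSEQ[where c = 1] assms; simp)+
  then have "(\<lambda>n. rpoly_op (p n + q n) S) \<longlonglongrightarrow> fc S f + fc S g"
    unfolding rpoly_op_simps by (rule tendsto_add)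
  moreover have "\<bar>f t + g t - poly (p n + q n) t\<bar> \<le> 2 * inverse (real (Suc n))" if "t \<in> rspec S" for n t
    using p[OF that, of n] q[OF that, of n] by simp
  then have "(\<lambda>n. rpoly_op (p n + q n) S) \<longlonglongrightarrow> fc S (\<lambda>t. f t + g t)"
    by (intro fc_LIMSEQ[where c = 2] S continuous_intros f g) auto
  ultimately show ?thesis by (rule LIMSEQ_unique[symmetric])
qed

lemma fc_mult:
  assumes S: "sa S" and f: "continuous_on (rspec S) f" and g: "continuous_on (rspec S) g"
  shows "fc S (\<lambda>t. f t * g t) = fc S f * fc S g"
proof -
  obtain p where p: "\<And>n t. t \<in> rspec S \<Longrightarrow> \<bar>f t - poly (p n) t\<bar> \<le> inverse (real (Suc n))"
    using approx_seq[OF S f] by blast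
  obtain q where q: "\<And>n t. t \<in> rspec S \<Longrightarrow> \<bar>g t - poly (q n) t\<bar> \<le> inverse (real (Suc n))"
    using approx_seq[OF S g] by blast
  have "(\<lambda>n. rpoly_op (p n) S) \<longlonglongrightarrow> fc S f" "(\<lambda>n. rpoly_op (q n) S) \<longlonglongrightarrow> fc S g"
    using p q by (intro fc_LIMSEQ[where c = 1] assms; simp)+
  then have "(\<lambda>n. rpoly_op (p n * q n) S) \<longlonglongrightarrow> fc S f * fc S g"
    unfolding rpoly_op_simps by (rule tendsto_mult)
  moreover
  have "bounded (f ` rspec S)" "bounded (g ` rspec S)"
    using compact_imp_bounded compact_continuous_image compact_rspec assms by blast+
  then obtain M N where M: "M > 0" "\<And>t. t \<in> rspec S \<Longrightarrow> \<bar>f t\<bar> \<le> M" and N: "N > 0" "\<And>t. t \<in> rspec S \<Longrightarrow> \<bar>g t\<bar> \<le> N"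
    unfolding bounded_pos by auto
  \<comment> \<open>As the error \<open>e\<close> is at most 1, the approximants of \<open>g\<close>
    are bounded by \<open>N + 1\<close>; the two error terms \<open>M * e\<close> and
    \<open>e * (N + 1)\<close> add up to the constant.\<close>
  have "\<bar>f t * g t - poly (p n * q n) t\<bar> \<le> (M + N + 1) * inverse (real (Suc n))" if "t \<in> rspec S" for n t
  proof -
    define e where "e = inverse (real (Suc n))"
    have e: "0 < e" "e \<le> 1" by (simp_all add: e_def field_simps)
    have *: "\<bar>f t - poly (p n) t\<bar> \<le> e" "\<bar>g t - poly (q n) t\<bar> \<le> e" using p q that by (auto simp: e_def)
    then have "\<bar>poly (q n) t\<bar> \<le> N + 1" using N(2)[OF that] e by linarith
    have "f t * g t - poly (p n * q n) t = f t * (g t - poly (q n) t) + (f t - poly (p n) t) * poly (q n) t"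
      by (simp add: algebra_simps)
    also have "\<bar>\<dots>\<bar> \<le> \<bar>f t\<bar> * \<bar>g t - poly (q n) t\<bar> + \<bar>f t - poly (p n) t\<bar> * \<bar>poly (q n) t\<bar>"
      by (metis abs_mult abs_triangle_ineq)
    also have "\<dots> \<le> M * e + e * (N + 1)"
      using * M(1,2) that \<open>\<bar>poly (q n) t\<bar> \<le> N + 1\<close> e by (intro add_mono mult_mono) auto
    finally show ?thesis by (simp add: e_def algebra_simps)
  qed
  then have "(\<lambda>n. rpoly_op (p n * q n) S) \<longlonglongrightarrow> fc S (\<lambda>t. f t * g t)"
    using M N by (intro fc_LIMSEQ[where c = "M + N + 1"] S continuous_intros f g) auto
  ultimately show ?thesis by (rule LIMSEQ_unique[symmetric])
qed

lemma fc_scale: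
  assumes "sa S" "continuous_on (rspec S) f"
  shows "fc S (\<lambda>t. r * f t) = r *\<^sub>R fc S f"
  using fc_mult[OF assms(1) continuous_on_const assms(2), of r] assms(1) by (simp add: fc_const)

lemma fc_diff:
  assumes "sa S" "continuous_on (rspec S) f" "continuous_on (rspec S) g"
  shows "fc S (\<lambda>t. f t - g t) = fc S f - fc S g"
proof -
  have "continuous_on (rspec S) (\<lambda>t. (- 1) * g t)" by (intro continuous_intros assms)
  from fc_add[OF assms(1,2) this] fc_scale[OF assms(1,3), of "- 1"] show ?thesis by simp
qed

lemma fc_dist_le:
  assumes "sa S" "continuous_on (rspec S) f" "continuous_on (rspec S) g" "0 \<le> c"
    and "\<And>t. t \<in> rspec S \<Longrightarrow> \<bar>f t - g t\<bar> \<le> c"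
  shows "norm (fc S f - fc S g) \<le> c"
  using fc_norm_le[of S "\<lambda>t. f t - g t" c] assms by (simp add: fc_diff continuous_on_diff)

text \<open>The spectrum being real, a complex function on it is treated through its real and
  imaginary parts, to which real polynomial approximation applies.\<close>

definition cfc_op :: "'h bop \<Rightarrow> (complex \<Rightarrow> complex) \<Rightarrow> 'h bop" where
  "cfc_op S f = fc S (\<lambda>t. Re (f (complex_of_real t))) + \<i> *\<^sub>C fc S (\<lambda>t. Im (f (complex_of_real t)))"

lemma continuous_on_Re_Im:
  assumes "continuous_on (complex_of_real ` K) f"
  shows "continuous_on K (\<lambda>t. Re (f (complex_of_real t)))" "continuous_on K (\<lambda>t. Im (f (complex_of_real t)))"
proof -
  have "continuous_on K (\<lambda>t. f (complex_of_real t))"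
    by (rule continuous_on_compose2[OF assms]) (auto intro: continuous_intros)
  then show "continuous_on K (\<lambda>t. Re (f (complex_of_real t)))" "continuous_on K (\<lambda>t. Im (f (complex_of_real t)))"
    by (intro continuous_intros; simp)+
qed

lemma adj_app:
  assumes "adjp S S'"
  shows "adj ip ip (app S) = app S'"
  using assms unfolding adjp_def by (rule adj_eq[OF hilbert_module_axioms])

lemma is_functional_calculus_cfc_op:
  assumes S: "sa S"
  shows "is_functional_calculus ip (app S) (\<lambda>f. app (cfc_op S f))"
  unfolding is_functional_calculus_def Let_def op_spectrum_sa[OF S] mem_Collect_eq Ball_Collect[symmetric]
proof (intro conjI ballI allI impI; (unfold mem_Collect_eq)?)
  fix f g :: "complex \<Rightarrow> complex" and c
  assume "continuous_on (complex_of_real ` rspec S) f"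
  note f = continuous_on_Re_Im[OF this]
  note fs = sa_fc[OF S f(1)] sa_fc[OF S f(2)]
  have adj: "adjp (cfc_op S f) (fc S (\<lambda>t. Re (f (complex_of_real t))) - \<i> *\<^sub>C fc S (\<lambda>t. Im (f (complex_of_real t))))"
    using adjp_intros(3)[OF fs(1) adjp_intros(8)[OF fs(2), of \<i>]] by (simp add: cfc_op_def scaleC_minus_left)
  then show "app (cfc_op S f) \<in> adjointable ip ip"
    by (auto simp: adjointable_def adjp_def)
  have "cfc_op S (\<lambda>z. cnj (f z)) = fc S (\<lambda>t. Re (f (complex_of_real t))) + \<i> *\<^sub>C fc S (\<lambda>t. (- 1) * Im (f (complex_of_real t)))"
    by (simp add: cfc_op_def)
  also have "\<dots> = fc S (\<lambda>t. Re (f (complex_of_real t))) - \<i> *\<^sub>C fc S (\<lambda>t. Im (f (complex_of_real t)))"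
    by (simp only: fc_scale[OF S f(2)]) (simp add: scaleC_minus_right)
  finally show "app (cfc_op S (\<lambda>z. cnj (f z))) = adj ip ip (app (cfc_op S f))"
    using adj_app[OF adj] by simp
  have "cfc_op S (\<lambda>z. c * f z) = c *\<^sub>C cfc_op S f"
  proof -
    have "fc S (\<lambda>t. Re c * Re (f (complex_of_real t)) - Im c * Im (f (complex_of_real t))) =
      Re c *\<^sub>R fc S (\<lambda>t. Re (f (complex_of_real t))) - Im c *\<^sub>R fc S (\<lambda>t. Im (f (complex_of_real t)))"
      by (subst fc_diff[OF S]) (auto intro!: continuous_intros f simp: fc_scale[OF S] f)
    moreover have "fc S (\<lambda>t. Re c * Im (f (complex_of_real t)) + Im c * Re (f (complex_of_real t))) =
      Re c *\<^sub>R fc S (\<lambda>t. Im (f (complex_of_real t))) + Im c *\<^sub>R fc S (\<lambda>t. Re (f (complex_of_real t)))"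
      by (subst fc_add[OF S]) (auto intro!: continuous_intros f simp: fc_scale[OF S] f)
    moreover have c: "c *\<^sub>C X = Re c *\<^sub>R X + \<i> *\<^sub>C (Im c *\<^sub>R X)" for X :: "'h bop"
      by (subst complex_eq[of c]) (simp add: scaleC_add_left scaleC_of_real[symmetric] scaleC_scaleC)
    have "c *\<^sub>C (A + \<i> *\<^sub>C B) = (Re c *\<^sub>R A - Im c *\<^sub>R B) + \<i> *\<^sub>C (Re c *\<^sub>R B + Im c *\<^sub>R A)" for A B :: "'h bop"
    proof -
      have "c *\<^sub>C (A + \<i> *\<^sub>C B) = c *\<^sub>C A + \<i> *\<^sub>C (c *\<^sub>C B)"
        by (simp add: scaleC_add_right scaleC_scaleC mult.commute)
      then show ?thesis by (simp add: c scaleC_add_right scaleC_scaleC scaleC_minus_left)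
    qed
    ultimately show ?thesis by (simp add: cfc_op_def)
  qed
  then show "app (cfc_op S (\<lambda>z. c * f z)) = (\<lambda>x. c *\<^sub>C app (cfc_op S f) x)"
    by (simp add: app_scaleC_left fun_eq_iff)
  assume "continuous_on (complex_of_real ` rspec S) g"
  note g = continuous_on_Re_Im[OF this]
  show "app (cfc_op S (\<lambda>z. f z + g z)) = (\<lambda>x. app (cfc_op S f) x + app (cfc_op S g) x)"
    by (simp add: cfc_op_def fc_add[OF S f(1) g(1)] fc_add[OF S f(2) g(2)] scaleC_add_right
        app_simps app_scaleC_left fun_eq_iff)
  have "cfc_op S (\<lambda>z. f z * g z) = cfc_op S f * cfc_op S g"
  proof -
    have "fc S (\<lambda>t. Re (f (complex_of_real t)) * Re (g (complex_of_real t)) - Im (f (complex_of_real t)) * Im (g (complex_of_real t)))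
      = fc S (\<lambda>t. Re (f (complex_of_real t))) * fc S (\<lambda>t. Re (g (complex_of_real t)))
       - fc S (\<lambda>t. Im (f (complex_of_real t))) * fc S (\<lambda>t. Im (g (complex_of_real t)))"
      by (subst fc_diff[OF S]) (auto intro!: continuous_intros f g simp: fc_mult[OF S] f g)
    moreover have "fc S (\<lambda>t. Re (f (complex_of_real t)) * Im (g (complex_of_real t)) + Im (f (complex_of_real t)) * Re (g (complex_of_real t)))
      = fc S (\<lambda>t. Re (f (complex_of_real t))) * fc S (\<lambda>t. Im (g (complex_of_real t)))
       + fc S (\<lambda>t. Im (f (complex_of_real t))) * fc S (\<lambda>t. Re (g (complex_of_real t)))"
      by (subst fc_add[OF S]) (auto intro!: continuous_intros f g simp: fc_mult[OF S] f g)
    ultimately show ?thesis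
      by (simp add: cfc_op_def mult_scaleC_bop scaleC_add_right scaleC_scaleC scaleC_minus_left distrib_left distrib_right)
  qed
  then show "app (cfc_op S (\<lambda>z. f z * g z)) = app (cfc_op S f) \<circ> app (cfc_op S g)"
    by (simp add: app_simps fun_eq_iff)
  assume "\<forall>z\<in>complex_of_real ` rspec S. f z = g z"
  then have "cfc_op S f = cfc_op S g"
    unfolding cfc_op_def by (auto intro!: arg_cong2[where f = "(+)"] arg_cong2[where f = scaleC] fc_cong)
  then show "app (cfc_op S f) = app (cfc_op S g)" by simp
qed (simp_all add: cfc_op_def fc_const[OF S] fc_id[OF S] app_simps fun_eq_iff)

section \<open>Uniqueness of the functional calculus\<close>

context
  fixes S :: "'h bop" and \<Phi> :: "(complex \<Rightarrow> complex) \<Rightarrow> 'h \<Rightarrow> 'h"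
  assumes S: "sa S" and \<Phi>: "is_functional_calculus ip (app S) \<Phi>"
begin

abbreviation (input) "cont f \<equiv> continuous_on (complex_of_real ` rspec S) f"

lemma calc:
  shows calc_adjointable: "cont f \<Longrightarrow> \<Phi> f \<in> adjointable ip ip"
  and calc_cong: "cont f \<Longrightarrow> cont g \<Longrightarrow> (\<And>t. t \<in> rspec S \<Longrightarrow> f (complex_of_real t) = g (complex_of_real t)) \<Longrightarrow> \<Phi> f = \<Phi> g"
  and calc_add: "cont f \<Longrightarrow> cont g \<Longrightarrow> \<Phi> (\<lambda>z. f z + g z) x = \<Phi> f x + \<Phi> g x"
  and calc_scale: "cont f \<Longrightarrow> \<Phi> (\<lambda>z. c * f z) x = c *\<^sub>C \<Phi> f x"
  and calc_mult: "cont f \<Longrightarrow> cont g \<Longrightarrow> \<Phi> (\<lambda>z. f z * g z) x = \<Phi> f (\<Phi> g x)"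
  and calc_cnj: "cont f \<Longrightarrow> \<Phi> (\<lambda>z. cnj (f z)) = adj ip ip (\<Phi> f)"
  and calc_one: "\<Phi> (\<lambda>z. 1) x = x"
  and calc_id: "\<Phi> (\<lambda>z. z) x = app S x"
proof -
  note D = \<Phi>[unfolded is_functional_calculus_def Let_def op_spectrum_sa[OF S]]
  note D1 = D[THEN conjunct2] note D2 = D1[THEN conjunct2] note D3 = D2[THEN conjunct2]
  note D4 = D3[THEN conjunct2] note D5 = D4[THEN conjunct2] note D6 = D5[THEN conjunct2]
  note D7 = D6[THEN conjunct2]
  show "cont f \<Longrightarrow> \<Phi> f \<in> adjointable ip ip"
    by (rule D[THEN conjunct1, THEN bspec]) simp
  show "cont f \<Longrightarrow> cont g \<Longrightarrow> (\<And>t. t \<in> rspec S \<Longrightarrow> f (complex_of_real t) = g (complex_of_real t)) \<Longrightarrow> \<Phi> f = \<Phi> g"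
    by (rule D1[THEN conjunct1, THEN bspec, THEN bspec, THEN mp]) auto
  show "cont f \<Longrightarrow> cont g \<Longrightarrow> \<Phi> (\<lambda>z. f z + g z) x = \<Phi> f x + \<Phi> g x"
    by (rule D2[THEN conjunct1, THEN bspec, THEN bspec, THEN fun_cong]) simp_all
  show "cont f \<Longrightarrow> \<Phi> (\<lambda>z. c * f z) x = c *\<^sub>C \<Phi> f x"
    by (rule D3[THEN conjunct1, THEN bspec, THEN spec, THEN fun_cong]) simp
  show "\<Phi> (\<lambda>z. f z * g z) x = \<Phi> f (\<Phi> g x)" if "cont f" "cont g"
    using that D4[THEN conjunct1, THEN bspec, THEN bspec, THEN fun_cong, of f g x] by simp
  show "cont f \<Longrightarrow> \<Phi> (\<lambda>z. cnj (f z)) = adj ip ip (\<Phi> f)"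
    by (rule D5[THEN conjunct1, THEN bspec]) simp
  show "\<Phi> (\<lambda>z. 1) x = x" using D6[THEN conjunct1, THEN fun_cong, of x] by simp
  show "\<Phi> (\<lambda>z. z) x = app S x" using D7[THEN fun_cong, of x] by simp
qed

lemma calc_const: "\<Phi> (\<lambda>z. c) x = c *\<^sub>C x"
  using calc_scale[of "\<lambda>z. 1" c x] by (simp add: calc_one)

lemma cont_real:
  assumes "continuous_on (rspec S) g"
  shows "cont (\<lambda>z. complex_of_real (g (Re z)))"
  by (intro continuous_on_of_real continuous_on_compose2[OF assms]) (auto intro: continuous_intros)

lemma calc_poly: "\<Phi> (\<lambda>z. complex_of_real (poly p (Re z))) x = app (rpoly_op p S) x"
proof (induction p arbitrary: x)
  case 0
  show ?case using calc_const[of 0 x] by (simp only: poly_0 of_real_0 scaleC_zero_left rpoly_op_simps(1) app_simps(1))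
next
  case (pCons a p)
  have c: "cont (\<lambda>z. complex_of_real (poly q (Re z)))" for q
    by (rule cont_real, rule continuous_on_poly, rule continuous_on_id)
  have id: "cont (\<lambda>z. z)" by (rule continuous_on_id)
  have m: "cont (\<lambda>z. z * complex_of_real (poly p (Re z)))"
    by (rule continuous_on_mult[OF id c])
  have const: "cont (\<lambda>z. complex_of_real a)" by (rule continuous_on_const)
  have "\<Phi> (\<lambda>z. complex_of_real (poly (pCons a p) (Re z))) x
      = \<Phi> (\<lambda>z. complex_of_real a + z * complex_of_real (poly p (Re z))) x"
    by (rule fun_cong[OF calc_cong[OF c continuous_on_add[OF const m]]]) simp
  also have "\<dots> = a *\<^sub>R x + app S (app (rpoly_op p S) x)"
    by (simp only: calc_add[OF const m] calc_mult[OF id c] calc_const calc_id pCons.IH scaleC_of_real)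
  finally show ?case unfolding rpoly_op_simps app_simps .
qed

text \<open>Continuity is not among the clauses of \<open>is_functional_calculus\<close>; it follows
  from the algebraic ones. With \<open>h\<close> the root of \<open>c\<^sup>2 - g\<^sup>2\<close>,
  the operators of \<open>g\<close> and \<open>h\<close> commute and their squares add up to
  \<open>c\<^sup>2\<close> times the identity, so \<open>norm_sa_sq_commuting\<close>
  applies.\<close>

lemma calc_bound:
  assumes g: "continuous_on (rspec S) g" and c: "0 \<le> c" "\<And>t. t \<in> rspec S \<Longrightarrow> \<bar>g t\<bar> \<le> c"
  shows "norm (\<Phi> (\<lambda>z. complex_of_real (g (Re z))) x) \<le> c * norm x"
proof -
  define r where "r u z = complex_of_real (u (Re z))" for u :: "real \<Rightarrow> real" and z
  \<comment> \<open>\<open>r u\<close> equals its own conjugate, so \<open>\<Phi>\<close> sends it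
    to a self-adjoint operator.\<close>
  have sa: "\<exists>G. app G = \<Phi> (r u) \<and> sa G" if u: "continuous_on (rspec S) u" for u
  proof -
    have cont: "cont (r u)" unfolding r_def by (rule cont_real[OF u])
    obtain G G' where G: "app G = \<Phi> (r u)" "adjp G G'"
      using adjointable_adjp[OF calc_adjointable[OF cont]] by blast
    then have "app G' = \<Phi> (\<lambda>z. cnj (r u z))" using adj_app calc_cnj[OF cont] by metis
    also have "(\<lambda>z. cnj (r u z)) = r u" by (simp add: r_def fun_eq_iff)
    finally have "G' = G" using G(1) by (metis bop_eqI)
    with G show ?thesis by blast
  qed
  define h where "h t = sqrt (c\<^sup>2 - (g t)\<^sup>2)" for t
  have h: "continuous_on (rspec S) h" unfolding h_def by (intro continuous_intros g)
  obtain G H where G: "app G = \<Phi> (r g)" "sa G" and H: "app H = \<Phi> (r h)" "sa H" using sa g h by metis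
  have cont: "cont (r g)" "cont (r h)" unfolding r_def by (intro cont_real g h)+
  have "\<Phi> (\<lambda>z. r g z * r h z) = \<Phi> (\<lambda>z. r h z * r g z)" by (simp add: mult.commute)
  then have comm: "G * H = H * G"
    by (intro bop_eqI) (metis app_simps(6) G(1) H(1) calc_mult cont)
  have "app (G * G + H * H) x = \<Phi> (\<lambda>z. r g z * r g z + r h z * r h z) x" for x
    by (subst calc_add, (intro continuous_intros cont)+) (simp add: calc_mult cont app_simps G H)
  moreover have "\<Phi> (\<lambda>z. r g z * r g z + r h z * r h z) = \<Phi> (\<lambda>z. complex_of_real (c\<^sup>2))"
  proof (rule calc_cong)
    fix t assume "t \<in> rspec S"
    then have "(g t)\<^sup>2 \<le> c\<^sup>2" using c by (metis power2_abs power_mono abs_ge_zero)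
    then have "g t * g t + h t * h t = c\<^sup>2" by (simp add: h_def power2_eq_square)
    then show "r g (complex_of_real t) * r g (complex_of_real t) + r h (complex_of_real t) * r h (complex_of_real t) = complex_of_real (c\<^sup>2)"
      by (simp add: r_def flip: of_real_mult of_real_add)
  qed (intro continuous_intros cont)+
  ultimately have sum: "app (G * G + H * H) x = c\<^sup>2 *\<^sub>R x" for x by (simp add: calc_const scaleC_of_real del: of_real_power)
  have "(norm (app G x))\<^sup>2 \<le> norm (ip x (c\<^sup>2 *\<^sub>R x))"
    using norm_sa_sq_commuting[OF G(2) H(2) comm, of x] unfolding sum .
  then have "(norm (app G x))\<^sup>2 \<le> (c * norm x)\<^sup>2"
    by (simp add: ip_scaleR norm_ip_self power_mult_distrib)
  moreover have "0 \<le> c * norm x" using c(1) by simp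
  ultimately have "norm (app G x) \<le> c * norm x" by (rule power2_le_imp_le)
  moreover have "r g = (\<lambda>z. complex_of_real (g (Re z)))" by (simp add: r_def fun_eq_iff)
  ultimately show ?thesis using G(1) by simp
qed

text \<open>The two sides agree on polynomials, and \<open>calc_bound\<close> carries uniform
  approximation through \<open>\<Phi>\<close>.\<close>

lemma calc_real:
  assumes g: "continuous_on (rspec S) g"
  shows "\<Phi> (\<lambda>z. complex_of_real (g (Re z))) x = app (fc S g) x"
proof -
  obtain p where p: "\<And>n t. t \<in> rspec S \<Longrightarrow> \<bar>g t - poly (p n) t\<bar> \<le> inverse (real (Suc n))"
    using approx_seq[OF S g] by blast
  have "(\<lambda>n. rpoly_op (p n) S) \<longlonglongrightarrow> fc S g"
    using p by (intro fc_LIMSEQ[where c = 1] S g) auto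
  then have "(\<lambda>n. app (rpoly_op (p n) S) x) \<longlonglongrightarrow> app (fc S g) x" by (rule tendsto_app)
  moreover have "(\<lambda>n. app (rpoly_op (p n) S) x) \<longlonglongrightarrow> \<Phi> (\<lambda>z. complex_of_real (g (Re z))) x"
  proof -
    have "norm (app (rpoly_op (p n) S) x - \<Phi> (\<lambda>z. complex_of_real (g (Re z))) x) \<le> norm x * inverse (real (Suc n))" for n
    proof -
      have cont: "cont (\<lambda>z. complex_of_real (u (Re z)))" if "continuous_on (rspec S) u" for u
        using that by (rule cont_real)
      have "\<Phi> (\<lambda>z. complex_of_real (g (Re z) - poly (p n) (Re z))) x
        = \<Phi> (\<lambda>z. complex_of_real (g (Re z)) + (- 1) * complex_of_real (poly (p n) (Re z))) x"
        by simp
      also have "\<dots> = \<Phi> (\<lambda>z. complex_of_real (g (Re z))) x - app (rpoly_op (p n) S) x"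
        by (subst calc_add, intro cont g, intro continuous_intros cont, subst calc_scale, intro cont continuous_intros)
           (simp add: calc_poly scaleC_minus_left)
      finally show ?thesis
        using calc_bound[of "\<lambda>t. g t - poly (p n) t" "inverse (real (Suc n))" x] p g
        by (simp add: norm_minus_commute mult.commute continuous_intros)
    qed
    then have "(\<lambda>n. app (rpoly_op (p n) S) x - \<Phi> (\<lambda>z. complex_of_real (g (Re z))) x) \<longlonglongrightarrow> 0"
      by (intro Lim_null_comparison[OF _ LIMSEQ_scaled_inverse[of "norm x"]]) simp
    then show ?thesis by (simp add: LIM_zero_iff)
  qed
  ultimately show ?thesis by (metis LIMSEQ_unique)
qed

lemma calc_eq:
  assumes "cont f"
  shows "\<Phi> f = app (cfc_op S f)"
proof
  fix x
  note f = continuous_on_Re_Im[OF assms]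
  define u where "u t = Re (f (complex_of_real t))" for t
  define v where "v t = Im (f (complex_of_real t))" for t
  have uv': "continuous_on (rspec S) u" "continuous_on (rspec S) v"
    using f by (simp_all add: u_def[abs_def] v_def[abs_def])
  note uv = this[THEN cont_real]
  have "\<Phi> f x = \<Phi> (\<lambda>z. complex_of_real (u (Re z)) + \<i> * complex_of_real (v (Re z))) x"
    by (rule fun_cong[OF calc_cong[OF assms]], intro continuous_on_add continuous_on_mult continuous_on_const uv)
      (simp add: u_def v_def complex_eq[symmetric])
  also have "\<dots> = \<Phi> (\<lambda>z. complex_of_real (u (Re z))) x + \<i> *\<^sub>C \<Phi> (\<lambda>z. complex_of_real (v (Re z))) x"
    by (subst calc_add, rule uv, intro continuous_on_mult continuous_on_const uv, subst calc_scale, rule uv) (rule refl)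
  also have "\<dots> = app (cfc_op S f) x"
    unfolding calc_real[OF uv'(1)] calc_real[OF uv'(2)]
    by (simp add: u_def[abs_def] v_def[abs_def] cfc_op_def app_simps app_scaleC_left)
  finally show "\<Phi> f x = app (cfc_op S f) x" .
qed

end

lemma cfc_eq:
  assumes "sa S" "continuous_on (complex_of_real ` rspec S) f"
  shows "cfc ip f (app S) = app (cfc_op S f)"
  unfolding cfc_def
proof (rule the_equality)
  show "\<exists>\<Phi>. is_functional_calculus ip (app S) \<Phi> \<and> app (cfc_op S f) = \<Phi> f"
    using is_functional_calculus_cfc_op[OF assms(1)] by blast
  show "R = app (cfc_op S f)" if "\<exists>\<Phi>. is_functional_calculus ip (app S) \<Phi> \<and> R = \<Phi> f" for R
    using that calc_eq[OF assms(1) _ assms(2)] by auto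
qed

lemma op_powr_eq:
  assumes S: "sa S" "rspec S \<subseteq> {0..}" and \<beta>: "\<beta> > 0"
  shows "op_powr ip (app S) \<beta> = app (fc S (\<lambda>t. t powr \<beta>))"
proof -
  have "continuous_on (complex_of_real ` rspec S) (\<lambda>z. complex_of_real (Re z powr \<beta>))"
    using S(2) \<beta> by (intro continuous_on_of_real continuous_on_powr' continuous_intros) auto
  then show ?thesis
    unfolding op_powr_def by (subst cfc_eq[OF S(1)]) (simp_all add: cfc_op_def fc_const[OF S(1)])
qed


section \<open>Positivity of \<open>T* T\<close>\<close>

lemma rspec_nonneg_iff: "rspec S \<subseteq> {0..} \<longleftrightarrow> (\<forall>\<mu>>0. inv_op (\<mu> *\<^sub>R 1 + S))"
proof -
  have "inv_op (\<mu> *\<^sub>R 1 + S) \<longleftrightarrow> - \<mu> \<notin> rspec S" for \<mu>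
    using inv_op_scaleR_iff[of "- 1" "\<mu> *\<^sub>R 1 + S"] by (simp add: rspec_def)
  then have "(\<forall>\<mu>>0. inv_op (\<mu> *\<^sub>R 1 + S)) \<longleftrightarrow> (\<forall>\<mu>>0. - \<mu> \<notin> rspec S)"
    by simp
  also have "\<dots> \<longleftrightarrow> rspec S \<subseteq> {0..}"
    by (metis (no_types, opaque_lifting) atLeast_iff minus_minus neg_less_0_iff_less not_le subset_iff)
  finally show ?thesis by blast
qed

lemma rspec_square_nonneg: "sa S \<Longrightarrow> rspec (S * S) \<subseteq> {0..}"
  unfolding rspec_nonneg_iff using bpos_inv_op[OF bpos_square] by blast

text \<open>Otherwise neither \<open>norm S\<close> nor \<open>- norm S\<close> would lie in the
  spectrum, against \<open>norm_attained\<close>.\<close>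

lemma sa_eq_0I:
  assumes "sa S" "rspec S \<subseteq> {0..}" "rspec (- S) \<subseteq> {0..}"
  shows "S = 0"
proof (rule ccontr)
  assume "S \<noteq> 0"
  then have "norm S > 0" by simp
  then have "inv_op (norm S *\<^sub>R 1 + S)" "inv_op (norm S *\<^sub>R 1 + - S)"
    using assms(2,3) unfolding rspec_nonneg_iff by blast+
  then show False using norm_attained[OF assms(1) \<open>S \<noteq> 0\<close>] by simp
qed

lemma adjp_mult_eq_0:
  assumes "adjp D D'" "D' * D = 0"
  shows "D = 0"
proof (rule bop_eqI)
  fix x
  have "(norm (app D x))\<^sup>2 = 0" using norm_app_sq[OF assms(1), of x] assms(2) by (simp add: app_simps ip_zero)
  then show "app D x = app 0 x" by (simp add: app_simps)
qed

lemma sa_cube_eq_0: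
  assumes "sa n" "n * n * n = 0"
  shows "n = 0"
proof -
  have "(n * n) * (n * n) = 0" using assms(2) by (simp add: mult.assoc[symmetric])
  then have "n * n = 0" using adjp_mult_eq_0[of "n * n" "n * n"] adjp_intros(5)[OF assms(1,1)] by simp
  then show ?thesis using adjp_mult_eq_0 assms(1) by blast
qed

text \<open>If \<open>R\<close> inverts \<open>\<mu> *\<^sub>R 1 + D * D'\<close>, then
  \<open>1 - D' * R * D\<close>, divided by \<open>\<mu>\<close>, inverts the operator with the
  factors exchanged.\<close>

lemma Jacobson_inv_op:
  assumes "inv_op (\<mu> *\<^sub>R 1 + D * D')" "adjp D D'" "\<mu> \<noteq> 0"
  shows "inv_op (\<mu> *\<^sub>R 1 + D' * D)"
proof -
  have "sa (\<mu> *\<^sub>R 1 + D * D')"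
    by (intro adjp_intros assms adjp_sym[OF assms(2)])
  then obtain R where R: "sa R" "R * (\<mu> *\<^sub>R 1 + D * D') = 1" "(\<mu> *\<^sub>R 1 + D * D') * R = 1"
    using inv_op_sa[OF assms(1)] by blast
  define A where "A = 1 - D' * R * D"
  have "A * (\<mu> *\<^sub>R 1 + D' * D) = \<mu> *\<^sub>R 1 + D' * D - D' * (R * (\<mu> *\<^sub>R 1 + D * D')) * D"
    by (simp add: A_def algebra_simps)
  then have l: "A * (\<mu> *\<^sub>R 1 + D' * D) = \<mu> *\<^sub>R 1" using R(2) by simp
  have "(\<mu> *\<^sub>R 1 + D' * D) * A = \<mu> *\<^sub>R 1 + D' * D - D' * ((\<mu> *\<^sub>R 1 + D * D') * R) * D"
    by (simp add: A_def algebra_simps)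
  then have r: "(\<mu> *\<^sub>R 1 + D' * D) * A = \<mu> *\<^sub>R 1" using R(3) by simp
  have "adjp A (1 - D' * (R * D))"
    unfolding A_def by (intro adjp_intros R assms adjp_sym[OF assms(2)])
  then have "adjp (inverse \<mu> *\<^sub>R A) (inverse \<mu> *\<^sub>R (1 - D' * (R * D)))" by (rule adjp_intros)
  moreover have "inverse \<mu> *\<^sub>R A * (\<mu> *\<^sub>R 1 + D' * D) = 1" "(\<mu> *\<^sub>R 1 + D' * D) * inverse \<mu> *\<^sub>R A = 1"
    using l r assms(3) by simp_all
  ultimately show ?thesis unfolding inv_op_def by blast
qed

definition neg_part :: "'h bop \<Rightarrow> 'h bop" where
  "neg_part S = fc S (\<lambda>t. max 0 (- t))"

text \<open>The 3/2 power of the negative part \<open>n\<close>: a self-adjoint root of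
  \<open>n * n * n\<close>, so that \<open>n * S * n\<close> becomes minus a square.\<close>

definition neg_root :: "'h bop \<Rightarrow> 'h bop" where
  "neg_root S = fc S (\<lambda>t. max 0 (- t) * sqrt (max 0 (- t)))"

lemma
  assumes S: "sa S"
  shows sa_neg_part: "sa (neg_part S)"
    and sa_neg_root: "sa (neg_root S)"
    and neg_root_square: "neg_root S * neg_root S = neg_part S * neg_part S * neg_part S"
    and neg_part_mult: "neg_part S * S * neg_part S = - (neg_part S * neg_part S * neg_part S)"
proof -
  have c: "continuous_on (rspec S) (\<lambda>t. max 0 (- t))"
    "continuous_on (rspec S) (\<lambda>t. max 0 (- t) * sqrt (max 0 (- t)))"
    "continuous_on (rspec S) (\<lambda>t. max 0 (- t) * max 0 (- t))"
    "continuous_on (rspec S) (\<lambda>t::real. t)"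
    by (intro continuous_intros)+
  show "sa (neg_part S)" "sa (neg_root S)"
    unfolding neg_part_def neg_root_def by (intro sa_fc S c)+
  have cube: "neg_part S * neg_part S * neg_part S = fc S (\<lambda>t. max 0 (- t) * max 0 (- t) * max 0 (- t))"
    unfolding neg_part_def by (simp only: fc_mult[OF S c(1,1)] fc_mult[OF S c(3,1)])
  show "neg_root S * neg_root S = neg_part S * neg_part S * neg_part S"
    unfolding cube unfolding neg_root_def fc_mult[OF S c(2,2), symmetric]
    by (rule fc_cong) (simp add: max_def)
  have "neg_part S * S * neg_part S = fc S (\<lambda>t. max 0 (- t) * t * max 0 (- t))"
    unfolding neg_part_def
    by (simp only: fc_mult[OF S c(1,4)] fc_mult[OF S continuous_on_mult[OF c(1,4)] c(1)] fc_id[OF S])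
  also have "\<dots> = fc S (\<lambda>t. (- 1) * (max 0 (- t) * max 0 (- t) * max 0 (- t)))"
    by (rule fc_cong) (simp add: max_def)
  also have "\<dots> = (- 1) *\<^sub>R fc S (\<lambda>t. max 0 (- t) * max 0 (- t) * max 0 (- t))"
    by (rule fc_scale[OF S]) (intro continuous_intros)
  finally show "neg_part S * S * neg_part S = - (neg_part S * neg_part S * neg_part S)"
    unfolding cube by simp
qed

text \<open>The cube of the negative part vanishes, hence the negative part itself. Since
  \<open>\<bar>t\<bar> = t + 2 * max 0 (- t)\<close>, the operator \<open>S\<close> is then the
  square of \<open>q\<close>.\<close>

lemma rspec_nonnegI:
  assumes S: "sa S" and "neg_root S * neg_root S = 0"
  shows "rspec S \<subseteq> {0..}"
proof -
  have "neg_part S = 0"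
    using assms sa_cube_eq_0[OF sa_neg_part[OF S]] neg_root_square[OF S] by simp
  define q where "q = fc S (\<lambda>t. sqrt \<bar>t\<bar>)"
  have c: "continuous_on (rspec S) (\<lambda>t. sqrt \<bar>t\<bar>)" "continuous_on (rspec S) (\<lambda>t. 2 * max 0 (- t))"
    "continuous_on (rspec S) (\<lambda>t. max 0 (- t))" "continuous_on (rspec S) (\<lambda>t::real. t)"
    by (intro continuous_intros)+
  have "q * q = fc S (\<lambda>t. t + 2 * max 0 (- t))"
    unfolding q_def fc_mult[OF S c(1,1), symmetric] by (rule fc_cong) (simp add: max_def)
  also have "\<dots> = S + 2 *\<^sub>R neg_part S"
    by (simp only: fc_add[OF S c(4,2)] fc_id[OF S] fc_scale[OF S c(3)] neg_part_def)
  finally have "S = q * q" using \<open>neg_part S = 0\<close> by simp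
  moreover have "sa q" unfolding q_def by (intro sa_fc S c)
  ultimately show ?thesis using rspec_square_nonneg by metis
qed

text \<open>The argument of Kaplansky: with \<open>D = T n\<close>, \<open>n\<close> the negative part of \<open>T* T\<close>, the operator
  \<open>D* D = - n\<^sup>3\<close> is negative, while \<open>D D*\<close> is positive because \<open>D* D + D D*\<close> is a sum of squares of
  self-adjoint operators; both have the same spectrum apart from \<open>0\<close>.\<close>

lemma rspec_adjp_mult_nonneg:
  assumes T: "adjp T T'"
  shows "rspec (T' * T) \<subseteq> {0..}"
proof -
  define Q where "Q = T' * T"
  have Q: "sa Q" unfolding Q_def by (rule adjp_intros(5)[OF adjp_sym[OF T] T, simplified])
  define n where "n = neg_part Q"
  define m where "m = neg_root Q"
  have n: "sa n" and m: "sa m" unfolding n_def m_def using sa_neg_part sa_neg_root Q by blast+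
  define D where "D = T * n"
  define D' where "D' = n * T'"
  have D: "adjp D D'" "adjp D' D" unfolding D_def D'_def using T n adjp_intros(5) adjp_sym by blast+
  have "D' * D = n * Q * n" by (simp add: D_def D'_def Q_def mult.assoc)
  then have DD: "D' * D = - (m * m)"
    using neg_root_square[OF Q] neg_part_mult[OF Q] by (simp add: n_def m_def)
  \<comment> \<open>\<open>X\<close> and \<open>Y\<close> are, up to sign, twice the real and
    imaginary parts of \<open>D\<close>.\<close>
  define X where "X = D + D'"
  define Y where "Y = \<i> *\<^sub>C (D - D')"
  have X: "sa X" unfolding X_def using adjp_intros(3)[OF D] by (simp add: add.commute)
  have "adjp Y (cnj \<i> *\<^sub>C (D' - D))"
    unfolding Y_def by (rule adjp_intros(8)[OF adjp_intros(4)[OF D]])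
  then have Y: "sa Y" by (simp add: Y_def scaleC_minus_left scaleC_minus_right[symmetric])
  have "X * X + Y * Y = 2 *\<^sub>R (D * D' + D' * D)"
    by (simp add: X_def Y_def mult_scaleC_bop scaleC_scaleC scaleC_minus_left scaleC_diff_right
        scaleC_add_right algebra_simps scaleR_2)
  then have "2 *\<^sub>R (D * D') = (X * X + Y * Y) + (m * m + m * m)"
    using DD by (simp add: scaleR_2 algebra_simps)
  moreover have "bpos \<dots>" by (intro bpos_add bpos_square X Y m)
  ultimately have b: "bpos (2 *\<^sub>R (D * D'))" by simp
  have "inv_op (\<mu> *\<^sub>R 1 + D * D')" if "\<mu> > 0" for \<mu>
  proof -
    have "inv_op ((2 * \<mu>) *\<^sub>R 1 + 2 *\<^sub>R (D * D'))"
      using bpos_inv_op[OF b, of "2 * \<mu>"] that by simp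
    also have "(2 * \<mu>) *\<^sub>R 1 + 2 *\<^sub>R (D * D') = 2 *\<^sub>R (\<mu> *\<^sub>R 1 + D * D')"
      by (simp add: scaleR_add_right)
    finally show ?thesis by (simp add: inv_op_scaleR_iff)
  qed
  \<comment> \<open>Positivity passes from \<open>D * D'\<close> to \<open>D' * D\<close>, which is
    \<open>- (m * m)\<close>, while \<open>m * m\<close> is positive as a square; both together
    force \<open>m * m = 0\<close>.\<close>
  then have "rspec (- (m * m)) \<subseteq> {0..}"
    unfolding rspec_nonneg_iff DD[symmetric] using Jacobson_inv_op[OF _ D(1)] by auto
  then have "m * m = 0"
    using sa_eq_0I[OF adjp_intros(5)[OF m m] rspec_square_nonneg[OF m]] by blast
  then show ?thesis
    using rspec_nonnegI[OF Q] unfolding m_def Q_def by blast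
qed

end

section \<open>Positivity in the algebra and for operators between two modules\<close>

lemma hilbert_module_self: "hilbert_module (*) (\<lambda>a b::'a::cstar_algebra. star a * b)"
proof (rule hilbert_module.intro)
  fix a b c :: 'a and z :: complex
  show "cstar_positive (star a * a)" by (auto simp: cstar_positive_def)
  show "a = 0" if "star a * a = 0" using that cstar_identity[of a] by simp
  show "norm a = sqrt (norm (star a * a))" by (simp add: cstar_identity)
qed (simp_all add: algebra_simps mult_scaleC_left mult_scaleC_right star_mult star_star)

text \<open>The left multiplication \<open>L (star c * c)\<close> has nonnegative spectrum for every
  \<open>c\<close>. By assumption \<open>star a * a\<close> and its negative
  \<open>star b * b\<close> both have this form, so \<open>L (star a * a) = 0\<close>.\<close>

lemma star_mult_add_eq_0:
  fixes a b :: "'a::cstar_algebra"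
  assumes "star a * a + star b * b = 0"
  shows "a = 0"
proof -
  interpret A: hilbert_module "(*)" "\<lambda>a b::'a. star a * b" by (rule hilbert_module_self)
  have "\<exists>L. app L = (\<lambda>x. c * x)" for c :: 'a
    using bop_of_fun[OF bounded_linear_mult_right, of c] mult_scaleC_right by metis
  then obtain L :: "'a \<Rightarrow> 'a bop" where L: "\<And>c. app (L c) = (\<lambda>x. c * x)" by metis
  have adj: "A.adjp (L c) (L (star c))" for c
    by (simp add: A.adjp_def is_adjoint_def L star_mult mult.assoc)
  have mult: "L (star c) * L c = L (star c * c)" for c
    by (rule bop_eqI) (simp add: app_simps L mult.assoc)
  have nonneg: "A.rspec (L (star c * c)) \<subseteq> {0..}" for c
    using A.rspec_adjp_mult_nonneg[OF adj[of c]] by (simp add: mult)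
  have "star b * b = - (star a * a)" using assms by (simp add: eq_neg_iff_add_eq_0 add.commute)
  then have "L (star b * b) = - L (star a * a)"
    by (intro bop_eqI) (simp add: app_simps L)
  then have "L (star a * a) = 0"
    using A.sa_eq_0I[of "L (star a * a)"] nonneg[of a] nonneg[of b] adj[of "star a * a"]
    by (simp add: star_mult star_star)
  \<comment> \<open>There is no unit to evaluate at. For \<open>d = star a * a\<close> the argument
    \<open>star d\<close> gives \<open>d * star d = 0\<close>, to which definiteness
    applies.\<close>
  then have "app (L (star a * a)) (star (star a * a)) = 0" by (simp add: app_simps)
  then have "star (star (star a * a)) * star (star a * a) = 0" by (simp add: L star_star)
  then have "star (star a * a) = 0" by (rule A.ip_definite)
  then have "star a * a = 0" by (metis star_star star_simps(1))
  then show "a = 0" by (rule A.ip_definite)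
qed

text \<open>For \<open>D\<close> from \<open>H\<close> to \<open>K\<close> the products
  \<open>D' D\<close> and \<open>D D'\<close> act on different modules and cannot be added. Instead
  \<open>n * P * n + m * m = 0\<close> is paired with \<open>x\<close>; this is a vanishing sum of
  two positive elements of the algebra, and \<open>star_mult_add_eq_0\<close> gives
  \<open>m = 0\<close>.\<close>

lemma rspec_adjoint_nonneg:
  assumes H: "hilbert_module actH ipH" and K: "hilbert_module actK ipK"
    and T: "is_adjoint ipH ipK T T'" and P: "app P = T' \<circ> T"
  shows "hilbert_module.adjp ipH P P" "hilbert_module.rspec ipH P \<subseteq> {0..}"
proof -
  interpret H: hilbert_module actH ipH by fact
  interpret K: hilbert_module actK ipK by fact
  have T1: "ipK (T x) y = ipH x (T' y)" for x y using T by (simp add: is_adjoint_def)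
  have T2: "ipH (T' y) x = ipK y (T x)" for x y
    using is_adjoint_sym[OF H K T] by (simp add: is_adjoint_def)
  show sa: "H.adjp P P" by (simp add: H.adjp_def is_adjoint_def P T1 T2)
  define n where "n = H.neg_part P"
  define m where "m = H.neg_root P"
  have n: "H.adjp n n" and m: "H.adjp m m"
    unfolding n_def m_def using H.sa_neg_part H.sa_neg_root sa by blast+
  have "m = 0"
  proof (rule bop_eqI)
    fix x
    have "n * P * n + m * m = 0"
      using H.neg_root_square[OF sa] H.neg_part_mult[OF sa] by (simp add: n_def m_def)
    then have "app (n * P * n) x + app (m * m) x = 0" by (metis app_simps(1,3))
    then have "ipH x (app n (T' (T (app n x)))) + ipH x (app m (app m x)) = 0"
      by (simp add: app_simps P H.ip_add_right[symmetric] H.ip_zero)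
    then have "ipK (T (app n x)) (T (app n x)) + ipH (app m x) (app m x) = 0"
      by (simp add: T1 H.adjpD[OF n] H.adjpD[OF m])
    moreover obtain a b where "ipK (T (app n x)) (T (app n x)) = star a * a" "ipH (app m x) (app m x) = star b * b"
      using H.ip_positive K.ip_positive unfolding cstar_positive_def by metis
    ultimately have "ipH (app m x) (app m x) = 0"
      using star_mult_add_eq_0[of b a] by (simp add: add.commute)
    then show "app m x = app 0 x" using H.ip_definite by (simp add: app_simps)
  qed
  then show "H.rspec P \<subseteq> {0..}" using H.rspec_nonnegI[OF sa] by (simp add: m_def)
qed

context hilbert_module
begin

text \<open>No spectral mapping theorem is invoked: \<open>I\<close> contains both the spectrum of
  \<open>fc S f\<close> and the image of \<open>f\<close>, and a polynomial close to
  \<open>g\<close> on the union \<open>K\<close> of the two approximates both sides.\<close>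

lemma fc_compose:
  assumes S: "sa S" and f: "continuous_on (rspec S) f" and g: "continuous_on I g"
    and I: "rspec (fc S f) \<subseteq> I" "f ` rspec S \<subseteq> I"
  shows "fc (fc S f) g = fc S (\<lambda>t. g (f t))"
proof -
  define R where "R = fc S f"
  have R: "sa R" unfolding R_def by (rule sa_fc[OF S f])
  define K where "K = rspec R \<union> f ` rspec S"
  have K: "compact K" "K \<subseteq> I"
    unfolding K_def using I compact_rspec[OF S] compact_rspec[OF R] f
    by (auto simp: R_def intro!: compact_Un compact_continuous_image)
  then have gK: "continuous_on K g" using g continuous_on_subset by blast
  have "continuous_on (rspec R) g" "continuous_on (f ` rspec S) g"
    using continuous_on_subset[OF gK] by (auto simp: K_def)
  note gR = this(1)
  have gf: "continuous_on (rspec S) (\<lambda>t. g (f t))"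
    by (rule continuous_on_compose2[OF \<open>continuous_on (f ` rspec S) g\<close> f]) simp
  have poly: "rpoly_op p R = fc S (\<lambda>t. poly p (f t))" for p
  proof (induction p)
    case (pCons a p)
    have p: "continuous_on (rspec S) (\<lambda>t. poly p (f t))" by (rule continuous_on_poly[OF f])
    have "fc S (\<lambda>t. a + f t * poly p (f t)) = a *\<^sub>R 1 + R * fc S (\<lambda>t. poly p (f t))"
      unfolding R_def
      by (simp only: fc_add[OF S continuous_on_const continuous_on_mult[OF f p]] fc_mult[OF S f p] fc_const[OF S])
    then show ?case by (simp only: rpoly_op_simps pCons.IH poly_pCons)
  qed (simp add: rpoly_op_simps fc_const[OF S])
  have small: "norm (fc R g - fc S (\<lambda>t. g (f t))) \<le> e" if e: "e > 0" for e
  proof -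
    obtain p where p: "\<And>t. t \<in> K \<Longrightarrow> \<bar>g t - poly p t\<bar> < e/2"
      using real_poly_approx[OF K(1) gK, of "e/2"] e by auto
    have "norm (fc R g - fc R (poly p)) \<le> e/2"
      using p e by (intro fc_dist_le R gR continuous_on_poly[OF continuous_on_id]) (auto simp: K_def less_imp_le)
    moreover have "norm (fc S (\<lambda>t. g (f t)) - fc S (\<lambda>t. poly p (f t))) \<le> e/2"
      using p e by (intro fc_dist_le S gf continuous_on_poly[OF f]) (auto simp: K_def less_imp_le)
    ultimately show ?thesis
      unfolding fc_poly[OF R] poly
      using norm_triangle_ineq4[of "fc R g - fc S (\<lambda>t. poly p (f t))" "fc S (\<lambda>t. g (f t)) - fc S (\<lambda>t. poly p (f t))"]
      by simp
  qed
  have "norm (fc R g - fc S (\<lambda>t. g (f t))) \<le> 0"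
    by (rule field_le_epsilon) (use small in simp)
  then show ?thesis by (simp add: R_def)
qed

end

section \<open>The operator \<open>V\<close>\<close>

text \<open>The difference \<open>d\<close> of two values is killed by \<open>A\<close>, hence
  orthogonal to the closure of the range of \<open>A'\<close>, which contains both values and so
  makes \<open>d\<close> orthogonal to itself.\<close>

lemma reduced_solution_unique:
  assumes H: "hilbert_module actH ipH" and K: "hilbert_module actK ipK" and A: "is_adjoint ipH ipK A A'"
    and D: "reduced_solution ipE ipH ipK A C D" and D': "reduced_solution ipE ipH ipK A C D'"
  shows "D = D'"
proof
  fix x
  interpret H: hilbert_module actH ipH by fact
  interpret K: hilbert_module actK ipK by fact
  define d where "d = D x - D' x"
  have "A (D x) = A (D' x)" using D D' by (auto simp: reduced_solution_def fun_eq_iff)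
  then have "A d = 0"
    unfolding d_def using linear_diff[OF bounded_linear.linear[OF is_adjoint_bounded_linear[OF H K A]]] by simp
  then have "ipH d (A' w) = 0" for w
    using A K.ip_zero(1) unfolding is_adjoint_def by metis
  then have "range A' \<subseteq> {u. ipH d u = 0}" by auto
  moreover have "closed {u. ipH d u = 0}"
    by (intro closed_Collect_eq linear_continuous_on continuous_on_const
          bounded_bilinear.bounded_linear_right[OF H.bounded_bilinear_ip])
  ultimately have "closure (range A') \<subseteq> {u. ipH d u = 0}" by (rule closure_minimal)
  moreover have "range D \<subseteq> closure (range A')" "range D' \<subseteq> closure (range A')"
    using D D' unfolding reduced_solution_def adj_eq[OF H A] by auto
  ultimately have "ipH d (D x) = 0" "ipH d (D' x) = 0" by blast+
  then have "ipH d d = 0" by (simp add: d_def H.ip_diff)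
  then have "d = 0" by (rule H.ip_definite)
  then show "D x = D' x" by (simp add: d_def)
qed

text \<open>Exchanging the two sides of the locale turns \<open>V\<close> into its adjoint, so every statement
  below yields a second one about the adjoint.\<close>

locale adjoint_pair =
  H: hilbert_module actH ipH + K: hilbert_module actK ipK
  for actH :: "'h::complex_banach \<Rightarrow> 'a::cstar_algebra \<Rightarrow> 'h" and ipH
    and actK :: "'k::complex_banach \<Rightarrow> 'a \<Rightarrow> 'k" and ipK +
  fixes T :: "'h \<Rightarrow> 'k" and T' :: "'k \<Rightarrow> 'h" and P :: "'h bop" and Q :: "'k bop"
  assumes T: "is_adjoint ipH ipK T T'" and P: "app P = T' \<circ> T" and Q: "app Q = T \<circ> T'"
begin

lemma T': "is_adjoint ipK ipH T' T"
  by (rule is_adjoint_sym[OF H.hilbert_module_axioms K.hilbert_module_axioms T])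

lemma swap: "adjoint_pair actK ipK actH ipH T' T Q P"
  by (rule adjoint_pair.intro[OF K.hilbert_module_axioms H.hilbert_module_axioms
        adjoint_pair_axioms.intro[OF T' Q P]])

lemma saP: "H.sa P" and rspecP: "H.rspec P \<subseteq> {0..}"
  using rspec_adjoint_nonneg[OF H.hilbert_module_axioms K.hilbert_module_axioms T P] by blast+

lemma bounded_linear_T: "bounded_linear T"
  by (rule is_adjoint_bounded_linear[OF H.hilbert_module_axioms K.hilbert_module_axioms T])

lemmas tendsto_T = bounded_linear.tendsto[OF bounded_linear_T]
lemmas T_linear = linear_add[OF bounded_linear.linear[OF bounded_linear_T]]
  linear_diff[OF bounded_linear.linear[OF bounded_linear_T]]
  linear_scale[OF bounded_linear.linear[OF bounded_linear_T]]
  linear_0[OF bounded_linear.linear[OF bounded_linear_T]]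

lemma adj_T: "adj ipH ipK T = T'"
  by (rule adj_eq[OF H.hilbert_module_axioms T])

lemma cont_powr:
  assumes "\<beta> > 0"
  shows "continuous_on {0::real..} (\<lambda>t. t powr \<beta>)"
  using assms by (intro continuous_on_powr' continuous_intros) auto

lemmas contP = continuous_on_subset[OF _ rspecP]

text \<open>In terms of |T| the exponent doubles: \<open>pw (1/2)\<close> is |T| and
  \<open>pw (1/4)\<close> is its square root.\<close>

definition pw :: "real \<Rightarrow> 'h bop" where
  "pw \<beta> = H.fc P (\<lambda>t. t powr \<beta>)"

lemma sa_pw: "\<beta> > 0 \<Longrightarrow> H.sa (pw \<beta>)"
  unfolding pw_def by (intro H.sa_fc saP contP cont_powr)

lemma pw_mult:
  assumes "\<beta> > 0" "\<gamma> > 0"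
  shows "pw \<beta> * pw \<gamma> = pw (\<beta> + \<gamma>)"
  unfolding pw_def using assms
  by (simp only: H.fc_mult[OF saP contP[OF cont_powr] contP[OF cont_powr], symmetric] powr_add)

lemma pw_one: "pw 1 = P"
proof -
  have "pw 1 = H.fc P (\<lambda>t. t)"
    unfolding pw_def using rspecP by (intro H.fc_cong) auto
  then show ?thesis by (simp add: H.fc_id saP)
qed

lemma op_abs_eq: "op_abs ipH ipK T = app (pw (1/2))"
  unfolding op_abs_def adj_T P[symmetric] pw_def by (rule H.op_powr_eq[OF saP rspecP]) simp

text \<open>A power of |T| is by definition an iterated calculus; \<open>fc_compose\<close> reduces
  it to a single one for \<open>P\<close>, which halves the exponent.\<close>

lemma op_powr_op_abs:
  assumes "\<beta> > 0"
  shows "op_powr ipH (op_abs ipH ipK T) \<beta> = app (pw (\<beta> / 2))"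
proof -
  have "pw (1/2) = pw (1/4) * pw (1/4)" by (simp add: pw_mult)
  then have nonneg: "H.rspec (pw (1/2)) \<subseteq> {0..}"
    using H.rspec_square_nonneg[OF sa_pw, of "1/4"] by simp
  have "H.fc (pw (1/2)) (\<lambda>t. t powr \<beta>) = H.fc P (\<lambda>t. (t powr (1/2)) powr \<beta>)"
    using nonneg unfolding pw_def
    by (intro H.fc_compose[where I = "{0..}"] saP contP cont_powr assms) auto
  then have "H.fc (pw (1/2)) (\<lambda>t. t powr \<beta>) = pw (\<beta> / 2)"
    by (simp add: powr_powr pw_def)
  then show ?thesis
    unfolding op_abs_eq using H.op_powr_eq[OF sa_pw nonneg assms] by simp
qed

text \<open>Induction settles polynomials. The spectra of \<open>P\<close> and \<open>Q\<close> may
  differ, so one sequence of polynomials is chosen on their union \<open>J\<close>.\<close>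

lemma T_fc:
  assumes f: "continuous_on {0..} f"
  shows "T (app (H.fc P f) x) = app (K.fc Q f) (T x)"
proof -
  interpret swap: adjoint_pair actK ipK actH ipH T' T Q P by (rule swap)
  define J where "J = H.rspec P \<union> K.rspec Q"
  have "J \<subseteq> {0..}" unfolding J_def using rspecP swap.rspecP by blast
  then have fJ: "continuous_on J f" using f continuous_on_subset by blast
  have fP: "continuous_on (H.rspec P) f" and fQ: "continuous_on (K.rspec Q) f"
    using continuous_on_subset[OF fJ] by (auto simp: J_def)
  have J: "compact J" unfolding J_def by (intro compact_Un H.compact_rspec K.compact_rspec saP swap.saP)
  have "\<forall>n. \<exists>p. \<forall>t\<in>J. \<bar>f t - poly p t\<bar> \<le> inverse (real (Suc n))"
  proof
    fix n
    have "0 < inverse (real (Suc n))" by simp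
    then obtain p where "\<And>t. t \<in> J \<Longrightarrow> \<bar>f t - poly p t\<bar> < inverse (real (Suc n))"
      using real_poly_approx[OF J fJ] by blast
    then show "\<exists>p. \<forall>t\<in>J. \<bar>f t - poly p t\<bar> \<le> inverse (real (Suc n))"
      by (intro exI[of _ p]) (simp add: less_imp_le)
  qed
  from choice[OF this] obtain p where p: "\<And>n t. t \<in> J \<Longrightarrow> \<bar>f t - poly (p n) t\<bar> \<le> inverse (real (Suc n))"
    by blast
  have poly: "T (app (rpoly_op q P) x) = app (rpoly_op q Q) (T x)" for q
  proof (induction q)
    case (pCons a q)
    then show ?case by (simp add: rpoly_op_simps app_simps T_linear P Q)
  qed (simp add: rpoly_op_simps app_simps T_linear)
  have "(\<lambda>n. rpoly_op (p n) P) \<longlonglongrightarrow> H.fc P f"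
    using p by (intro H.fc_LIMSEQ[where c = 1] saP fP) (auto simp: J_def)
  then have "(\<lambda>n. T (app (rpoly_op (p n) P) x)) \<longlonglongrightarrow> T (app (H.fc P f) x)"
    by (intro tendsto_T tendsto_app)
  moreover have "(\<lambda>n. rpoly_op (p n) Q) \<longlonglongrightarrow> K.fc Q f"
    using p by (intro K.fc_LIMSEQ[where c = 1] swap.saP fQ) (auto simp: J_def)
  then have "(\<lambda>n. app (rpoly_op (p n) Q) (T x)) \<longlonglongrightarrow> app (K.fc Q f) (T x)"
    by (rule tendsto_app)
  ultimately show ?thesis unfolding poly by (rule LIMSEQ_unique)
qed

lemma ip_T: "ipK (T x) (T y) = ipH (app (pw (1/2)) x) (app (pw (1/2)) y)"
proof -
  have "ipH (app (pw (1/2)) x) (app (pw (1/2)) y) = ipH x (app (pw (1/2)) (app (pw (1/2)) y))"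
    by (rule H.adjpD[OF sa_pw]) simp
  also have "app (pw (1/2)) (app (pw (1/2)) y) = app P y"
    by (simp add: pw_mult pw_one flip: app_simps(6))
  finally show ?thesis using T by (simp add: is_adjoint_def P)
qed

lemma norm_T: "norm (T x) = norm (app (pw (1/2)) x)"
  by (simp add: K.norm_eq_sqrt_ip[of "T x"] H.norm_eq_sqrt_ip[of "app (pw (1/2)) x"] ip_T)

text \<open>\<open>g n\<close> regularizes \<open>t\<^bsup>-1/4\<^esup>\<close>, and \<open>V = T |T|\<^bsup>-1/2\<^esup>\<close>.\<close>

definition g :: "nat \<Rightarrow> real \<Rightarrow> real" where
  "g n t = 1 / (t powr (1/4) + inverse (real (Suc n)))"

definition G :: "nat \<Rightarrow> 'h bop" where
  "G n = H.fc P (g n)"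

lemma cont_g: "continuous_on {0..} (g n)"
proof -
  have "t powr (1/4) + inverse (real (Suc n)) \<noteq> 0" for t :: real
    using add_nonneg_pos[of "t powr (1/4)" "inverse (real (Suc n))"] by simp
  then show ?thesis
    unfolding g_def by (intro continuous_intros cont_powr) auto
qed

lemma pw_G_LIMSEQ: "(\<lambda>n. app (pw (1/2)) (app (G n) x)) \<longlonglongrightarrow> app (pw (1/4)) x"
proof -
  have near: "\<bar>t powr (1/2) * g n t - t powr (1/4)\<bar> \<le> inverse (real (Suc n))" for n and t :: real
  proof -
    \<comment> \<open>In these terms the error is
      \<open>s * s / (s + e) - s = - (s * e / (s + e))\<close>, which is at most \<open>e\<close> in
      modulus, uniformly in \<open>t\<close>.\<close>
    define s where "s = t powr (1/4)"
    define e where "e = inverse (real (Suc n))"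
    have se: "s \<ge> 0" "e > 0" by (simp_all add: s_def e_def)
    have "t powr (1/2) = s * s" by (simp add: s_def flip: powr_add)
    then have "t powr (1/2) * g n t - t powr (1/4) = - (s * e / (s + e))"
      using se unfolding g_def s_def[symmetric] e_def[symmetric] by (simp add: field_simps)
    then have "\<bar>t powr (1/2) * g n t - t powr (1/4)\<bar> = s * e / (s + e)"
      using se by simp
    also have "\<dots> \<le> e" using se by (simp add: field_simps)
    finally show ?thesis by (simp only: e_def)
  qed
  have c: "continuous_on {0::real..} (\<lambda>t. t powr (1/2))" "continuous_on {0::real..} (\<lambda>t. t powr (1/4))"
    by (rule cont_powr, simp)+
  have "norm (pw (1/2) * G n - pw (1/4)) \<le> inverse (real (Suc n))" for n
    unfolding pw_def G_def H.fc_mult[OF saP contP[OF c(1)] contP[OF cont_g], symmetric]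
    by (rule H.fc_dist_le[OF saP contP[OF continuous_on_mult[OF c(1) cont_g]] contP[OF c(2)] _ near]) simp
  then have "(\<lambda>n. pw (1/2) * G n - pw (1/4)) \<longlonglongrightarrow> 0"
    by (intro Lim_null_comparison[OF _ LIMSEQ_inverse_real_of_nat]) simp
  then have "(\<lambda>n. pw (1/2) * G n) \<longlonglongrightarrow> pw (1/4)" by (simp add: LIM_zero_iff)
  from tendsto_app[OF this, of x] show ?thesis by (simp add: app_simps)
qed

text \<open>The limit is taken pointwise because \<open>T\<close> acts between two modules, while
  the normed algebra \<open>bop\<close> contains endomorphisms only.\<close>

definition V :: "'h \<Rightarrow> 'k" where
  "V x = lim (\<lambda>n. T (app (G n) x))"

lemma V_LIMSEQ: "(\<lambda>n. T (app (G n) x)) \<longlonglongrightarrow> V x"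
proof -
  have "Cauchy (\<lambda>n. app (pw (1/2)) (app (G n) x))"
    using pw_G_LIMSEQ by (rule LIMSEQ_imp_Cauchy)
  moreover have "dist (T (app (G m) x)) (T (app (G n) x)) = dist (app (pw (1/2)) (app (G m) x)) (app (pw (1/2)) (app (G n) x))" for m n
    by (simp add: dist_norm norm_T flip: T_linear(2) app_linear(3))
  ultimately have "Cauchy (\<lambda>n. T (app (G n) x))" unfolding Cauchy_def by simp
  then show ?thesis unfolding V_def by (simp add: Cauchy_convergent_iff convergent_LIMSEQ_iff)
qed

lemma V_fc:
  assumes f: "continuous_on {0..} f"
  shows "V (app (H.fc P f) x) = app (K.fc Q f) (V x)"
proof (rule LIMSEQ_unique[OF V_LIMSEQ])
  have "G n * H.fc P f = H.fc P f * G n" for n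
    unfolding G_def H.fc_mult[OF saP contP[OF cont_g] contP[OF f], symmetric]
      H.fc_mult[OF saP contP[OF f] contP[OF cont_g], symmetric]
    by (simp add: mult.commute)
  then have "T (app (G n) (app (H.fc P f) x)) = app (K.fc Q f) (T (app (G n) x))" for n
    unfolding T_fc[OF f, symmetric] by (metis app_simps(6))
  then show "(\<lambda>n. T (app (G n) (app (H.fc P f) x))) \<longlonglongrightarrow> app (K.fc Q f) (V x)"
    using bounded_linear.tendsto[OF bounded_linear_app V_LIMSEQ] by simp
qed

text \<open>The vectors \<open>y n\<close> themselves are not shown to converge to \<open>x\<close>.
  They do so after applying \<open>pw (1/2)\<close>, and by \<open>norm_T\<close> this suffices for
  \<open>T\<close>.\<close>

lemma V_pw: "V (app (pw (1/4)) x) = T x"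
proof (rule LIMSEQ_unique[OF V_LIMSEQ])
  define y where "y n = app (G n) (app (pw (1/4)) x)" for n
  have "(\<lambda>n. app (pw (1/2)) (y n)) \<longlonglongrightarrow> app (pw (1/4)) (app (pw (1/4)) x)"
    unfolding y_def by (rule pw_G_LIMSEQ)
  moreover have "app (pw (1/4)) (app (pw (1/4)) x) = app (pw (1/2)) x"
    by (simp add: pw_mult flip: app_simps(6))
  ultimately have "(\<lambda>n. norm (app (pw (1/2)) (y n) - app (pw (1/2)) x)) \<longlonglongrightarrow> 0"
    by (simp add: LIM_zero tendsto_norm_zero)
  then have "(\<lambda>n. norm (T (y n) - T x)) \<longlonglongrightarrow> 0"
    by (simp add: norm_T flip: T_linear(2) app_linear(3))
  then show "(\<lambda>n. T (app (G n) (app (pw (1/4)) x))) \<longlonglongrightarrow> T x"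
    unfolding y_def by (simp add: tendsto_norm_zero_iff LIM_zero_iff)
qed

lemma ip_V: "ipK (V x) (V y) = ipH x (app (pw (1/2)) y)"
proof -
  have "(\<lambda>n. ipK (T (app (G n) x)) (T (app (G n) y))) \<longlonglongrightarrow> ipK (V x) (V y)"
    by (intro K.tendsto_ip V_LIMSEQ)
  moreover have "(\<lambda>n. ipK (T (app (G n) x)) (T (app (G n) y))) \<longlonglongrightarrow> ipH (app (pw (1/4)) x) (app (pw (1/4)) y)"
    unfolding ip_T by (intro H.tendsto_ip pw_G_LIMSEQ)
  ultimately have "ipK (V x) (V y) = ipH (app (pw (1/4)) x) (app (pw (1/4)) y)"
    by (rule LIMSEQ_unique)
  also have "\<dots> = ipH x (app (pw (1/4)) (app (pw (1/4)) y))"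
    by (rule H.adjpD[OF sa_pw]) simp
  also have "app (pw (1/4)) (app (pw (1/4)) y) = app (pw (1/2)) y"
    by (simp add: pw_mult flip: app_simps(6))
  finally show ?thesis .
qed

text \<open>Values of \<open>V\<close> are limits of values of \<open>T\<close> by construction;
  conversely \<open>V_pw\<close> exhibits each \<open>T x\<close> as a value of
  \<open>V\<close>.\<close>

lemma closure_range_V: "closure (range V) = closure (range T)"
proof
  have "V x \<in> closure (range T)" for x
    unfolding closure_sequential by (rule exI[of _ "\<lambda>n. T (app (G n) x)"]) (simp add: V_LIMSEQ)
  then show "closure (range V) \<subseteq> closure (range T)" by (intro closure_minimal) auto
  have "T x \<in> range V" for x by (rule range_eqI, rule V_pw[symmetric])
  then have "range T \<subseteq> range V" by blast
  then show "closure (range T) \<subseteq> closure (range V)" by (rule closure_mono)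
qed

end

section \<open>The adjoint of \<open>V\<close> and the reduced solutions\<close>

sublocale adjoint_pair \<subseteq> swap: adjoint_pair actK ipK actH ipH T' T Q P
  by (rule swap)

context adjoint_pair
begin

text \<open>The adjoint of \<open>T\<close> after \<open>G n\<close> is \<open>G n\<close> after
  \<open>T'\<close>, which the exchanged form of \<open>T_fc\<close> turns into \<open>T'\<close>
  after \<open>swap.G n\<close>, the sequence defining \<open>swap.V\<close>.\<close>

lemma is_adjoint_V: "is_adjoint ipH ipK V swap.V"
  unfolding is_adjoint_def
proof (intro allI LIMSEQ_unique)
  fix x y
  show "(\<lambda>n. ipK (T (app (G n) x)) y) \<longlonglongrightarrow> ipK (V x) y"
    by (intro K.tendsto_ip V_LIMSEQ tendsto_const)
  have "ipK (T (app (G n) x)) y = ipH x (T' (app (swap.G n) y))" for n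
  proof -
    have "ipK (T (app (G n) x)) y = ipH (app (G n) x) (T' y)"
      using T by (simp add: is_adjoint_def)
    also have "\<dots> = ipH x (app (G n) (T' y))"
      by (rule H.adjpD) (auto simp: G_def intro: H.sa_fc saP contP cont_g)
    also have "app (G n) (T' y) = T' (app (swap.G n) y)"
      unfolding G_def swap.G_def using swap.T_fc[OF cont_g, of n y] by (simp add: g_def[abs_def] swap.g_def[abs_def])
    finally show ?thesis .
  qed
  then show "(\<lambda>n. ipK (T (app (G n) x)) y) \<longlonglongrightarrow> ipH x (swap.V y)"
    by (simp add: H.tendsto_ip swap.V_LIMSEQ)
qed

lemma adj_V: "adj ipH ipK V = swap.V"
  by (rule adj_eq[OF H.hilbert_module_axioms is_adjoint_V])

lemma swap_V_V: "swap.V (V x) = app (pw (1/2)) x"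
proof (rule H.ip_eqI)
  show "ipH z (swap.V (V x)) = ipH z (app (pw (1/2)) x)" for z
    using is_adjoint_V ip_V by (simp add: is_adjoint_def)
qed

lemma V_pw_swap: "\<beta> > 0 \<Longrightarrow> V (app (pw \<beta>) x) = app (swap.pw \<beta>) (V x)"
  unfolding pw_def swap.pw_def by (rule V_fc[OF cont_powr])

text \<open>Moving |T*|^(1/2) past \<open>V\<close> gives V |T|^(1/2), which is \<open>T\<close> by
  \<open>V_pw\<close>. Hence the range of the self-adjoint operator |T*|^(1/2) contains that of
  \<open>T\<close>, and its closure contains the range of \<open>V\<close>.\<close>

lemma reduced_solution_V:
  "reduced_solution ipH ipK ipK (op_powr ipK (op_abs ipK ipH T') (1/2)) T V"
proof -
  have B: "op_powr ipK (op_abs ipK ipH T') (1/2) = app (swap.pw (1/4))"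
    using swap.op_powr_op_abs[of "1/2"] by simp
  have BV: "app (swap.pw (1/4)) (V x) = T x" for x
    using V_pw_swap[of "1/4" x] V_pw by simp
  have "T x \<in> range (app (swap.pw (1/4)))" for x
    by (rule range_eqI, rule BV[symmetric])
  then have "closure (range T) \<subseteq> closure (range (app (swap.pw (1/4))))"
    by (intro closure_mono) auto
  then have "range V \<subseteq> closure (range (app (swap.pw (1/4))))"
    using closure_range_V closure_subset by blast
  moreover have "adj ipK ipK (app (swap.pw (1/4))) = app (swap.pw (1/4))"
    by (rule K.adj_app[OF swap.sa_pw]) simp
  ultimately show ?thesis
    unfolding reduced_solution_def B using is_adjoint_V BV by (auto simp: adjointable_def)
qed

end

theorem corollary3p2:
  fixes actH :: "'h::complex_banach \<Rightarrow> 'a::cstar_algebra \<Rightarrow> 'h"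
    and ipH :: "'h \<Rightarrow> 'h \<Rightarrow> 'a"
    and actK :: "'k::complex_banach \<Rightarrow> 'a \<Rightarrow> 'k"
    and ipK :: "'k \<Rightarrow> 'k \<Rightarrow> 'a"
    and T :: "'h \<Rightarrow> 'k"
  assumes "hilbert_module actH ipH"
    and "hilbert_module actK ipK"
    and "T \<in> adjointable ipH ipK"
  shows "(\<exists>!V. common_reduced_solution ipH ipK T V) \<and>
    (\<forall>V. common_reduced_solution ipH ipK T V \<longrightarrow>
      adj ipH ipK V \<circ> V = op_abs ipH ipK T \<and>
      V \<circ> adj ipH ipK V = op_abs ipK ipH (adj ipH ipK T) \<and>
      (\<forall>\<beta>>0. V \<circ> op_powr ipH (op_abs ipH ipK T) \<beta> =
              op_powr ipK (op_abs ipK ipH (adj ipH ipK T)) \<beta> \<circ> V) \<and>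
      closure (range V) = closure (range T) \<and>
      closure (range (adj ipH ipK V)) = closure (range (adj ipH ipK T)))"
proof -
  obtain T' where T: "is_adjoint ipH ipK T T'" using assms(3) by (auto simp: adjointable_def)
  note T' = is_adjoint_sym[OF assms(1,2) T]
  have "is_adjoint ipH ipH (T' \<circ> T) (T' \<circ> T)" "is_adjoint ipK ipK (T \<circ> T') (T \<circ> T')"
    using T T' by (simp_all add: is_adjoint_def)
  then obtain P Q where "app P = T' \<circ> T" "app Q = T \<circ> T'"
    using hilbert_module.adjointable_bop assms(1,2) by metis
  with assms(1,2) T interpret adjoint_pair actH ipH actK ipK T T' P Q
    by (intro adjoint_pair.intro adjoint_pair_axioms.intro)
  define W where "W = V"
  have sol: "common_reduced_solution ipH ipK T W"
    unfolding W_def common_reduced_solution_def adj_T adj_V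
    using reduced_solution_V swap.reduced_solution_V is_adjoint_V by (auto simp: adjointable_def)
  \<comment> \<open>The coefficient is bounded and self-adjoint; this provides the adjoint that
    \<open>reduced_solution_unique\<close> asks for.\<close>
  have "is_adjoint ipK ipK (op_powr ipK (op_abs ipK ipH T') (1/2)) (app (swap.pw (1/4)))"
    using swap.op_powr_op_abs[of "1/2"] swap.sa_pw[of "1/4"] by (simp add: K.adjp_def)
  then have unique: "U = W" if "common_reduced_solution ipH ipK T U" for U
    using that sol unfolding common_reduced_solution_def adj_T
    by (blast intro: reduced_solution_unique[OF assms(2,2)])
  have "adj ipH ipK W \<circ> W = op_abs ipH ipK T" "W \<circ> adj ipH ipK W = op_abs ipK ipH (adj ipH ipK T)"
    unfolding W_def adj_V adj_T op_abs_eq swap.op_abs_eq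
    by (simp_all add: fun_eq_iff swap_V_V swap.swap_V_V)
  moreover have "W \<circ> op_powr ipH (op_abs ipH ipK T) \<beta>
      = op_powr ipK (op_abs ipK ipH (adj ipH ipK T)) \<beta> \<circ> W" if "\<beta> > 0" for \<beta>
    unfolding W_def adj_T op_powr_op_abs[OF that] swap.op_powr_op_abs[OF that]
    using V_pw_swap[of "\<beta> / 2"] that by (simp add: fun_eq_iff)
  moreover have "closure (range W) = closure (range T)"
    "closure (range (adj ipH ipK W)) = closure (range (adj ipH ipK T))"
    unfolding W_def adj_V adj_T by (rule closure_range_V swap.closure_range_V)+
  ultimately show ?thesis
    using sol unique by blast
qed

end
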